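(* Let $n\ge 3$ and $0<s,t\le 1$. Then every $(n-2+s,t)_{n-1}$-Furstenberg set of hypersurfaces $E\subset\mathbb{R}^n$ (with parameter set a cinematic family $F\subset C^2([0,1]^{n-1},[0,1])$) satisfies $$\dim_H(E)\ge n-2+s+\min\{t,s\}.$$
   Context: Cinematic family: let $U\subset\mathbb{R}^k$ be a domain and $F\subset C^2(U)$, equipped with the metric induced by the usual $C^2(U)$ norm $\|\cdot\|_{C^2(U)}$. For $\xi\in S^{k-1}$ write $\nabla_\xi\nabla_\xi f=\langle\nabla^2 f\,\xi,\xi\rangle$. $F$ is a cinematic family with cinematic constant $K$, doubling constant $D$ and modulus of continuity $\alpha$ if: (1) $F$ is contained in a ball of diameter $K$ in $C^2(U)$; (2) $F$ is a doubling metric space with doubling constant at most $D$; (3) for all $f,g\in F$ and all $\xi\in S^{k-1}$, $\inf_{x\in U}\{|f(x)-g(x)|+|\nabla f(x)-\nabla g(x)|+|\nabla_\xi\nabla_\xi f(x)-\nabla_\xi\nabla_\xi g(x)|\}\ge K^{-1}\|f-g\|_{C^2(U)}$; (4) there is an increasing continuous $\alpha:[0,1]\to[0,\infty)$ with $\alpha(0)=0$ and $0<\alpha(s)\le K^{-1}s$ for $s\in(0,1]$ such that for all $f,g\in F$, all $\xi\in S^{k-1}$, all sufficiently small $\eta>0$ and all $x,y\in U$ with $|x-y|\le\alpha(\eta)$, $|\nabla_\xi\nabla_\xi(f-g)(x)-\nabla_\xi\nabla_\xi(f-g)(y)|\le\eta$. Furstenberg set: for $s,t>0$ and a cinematic family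 $F\subset C^2([0,1]^{n-1},[0,1])$, a set $E\subset\mathbb{R}^n$ is an $(s,t)_{n-1}$-Furstenberg set of hypersurfaces with parameter set $F$ if $\dim_H F\ge t$ (Hausdorff dimension with respect to the $C^2$-norm metric) and $\dim_H(E\cap\mathrm{graph}(f))\ge s$ for every $f\in F$. *)

theory Defs
  imports "HOL-Analysis.Analysis"
begin

definition hpow :: "real \<Rightarrow> real \<Rightarrow> ennreal" where
  "hpow s r = (if r = 0 then (if s = 0 then 1 else 0) else ennreal (r powr s))"

definition sdiam :: "('a \<Rightarrow> 'a \<Rightarrow> real) \<Rightarrow> 'a set \<Rightarrow> real" where
  "sdiam d X = (SUP x\<in>X. SUP y\<in>X. d x y)"

definition hausdorff_pre :: "('a \<Rightarrow> 'a \<Rightarrow> real) \<Rightarrow> real \<Rightarrow> real \<Rightarrow> 'a set \<Rightarrow> ennreal" where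
  "hausdorff_pre d s \<delta> A =
     (INF C\<in>{C::nat \<Rightarrow> 'a set. (\<forall>n. C n \<subseteq> A \<and> (\<forall>x\<in>C n. \<forall>y\<in>C n. d x y \<le> \<delta>)) \<and> A \<subseteq> (\<Union>n. C n)}.
        (\<Sum>n. (if C n = {} then 0 else hpow s (sdiam d (C n)))))"

definition hausdorff_measure :: "('a \<Rightarrow> 'a \<Rightarrow> real) \<Rightarrow> real \<Rightarrow> 'a set \<Rightarrow> ennreal" where
  "hausdorff_measure d s A = (SUP \<delta>\<in>{0<..}. hausdorff_pre d s \<delta> A)"

definition hdim :: "('a \<Rightarrow> 'a \<Rightarrow> real) \<Rightarrow> 'a set \<Rightarrow> ereal" where
  "hdim d A = Inf {ereal s | s. 0 \<le> s \<and> hausdorff_measure d s A = 0}"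

definition unit_cube :: "(real^'n) set" where
  "unit_cube = cbox 0 One"

definition grad :: "(real^'n \<Rightarrow> real) \<Rightarrow> real^'n \<Rightarrow> real^'n" where
  "grad f x = (\<chi> i. frechet_derivative f (at x) (axis i 1))"

definition hess :: "(real^'n \<Rightarrow> real) \<Rightarrow> real^'n \<Rightarrow> real^'n^'n" where
  "hess f x = (\<chi> i j. frechet_derivative (\<lambda>y. grad f y $ j) (at x) (axis i 1))"

definition dxi :: "real^'n \<Rightarrow> (real^'n \<Rightarrow> real) \<Rightarrow> real^'n \<Rightarrow> real" where
  "dxi \<xi> f x = \<xi> \<bullet> (hess f x *v \<xi>)"

definition C2_on :: "(real^'n) set \<Rightarrow> (real^'n \<Rightarrow> real) \<Rightarrow> bool" where
  "C2_on S f \<longleftrightarrow> open S \<and> f differentiable_on S \<and>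
     (\<forall>j. (\<lambda>y. grad f y $ j) differentiable_on S) \<and> continuous_on S (hess f)"

definition C2_cube :: "(real^'n \<Rightarrow> real) set" where
  "C2_cube = {f. \<exists>S. unit_cube \<subseteq> S \<and> C2_on S f}"

definition C2_cube_unit :: "(real^'n \<Rightarrow> real) set" where
  "C2_cube_unit = {f\<in>C2_cube. f ` unit_cube \<subseteq> {0..1}}"

definition c2norm :: "(real^'n \<Rightarrow> real) \<Rightarrow> real" where
  "c2norm f = (SUP x\<in>unit_cube. \<bar>f x\<bar>) + (SUP x\<in>unit_cube. norm (grad f x))
              + (SUP x\<in>unit_cube. onorm (\<lambda>v. hess f x *v v))"

definition c2dist :: "(real^'n \<Rightarrow> real) \<Rightarrow> (real^'n \<Rightarrow> real) \<Rightarrow> real" where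
  "c2dist f g = c2norm (\<lambda>x. f x - g x)"

definition doubling :: "('a \<Rightarrow> 'a \<Rightarrow> real) \<Rightarrow> 'a set \<Rightarrow> real \<Rightarrow> bool" where
  "doubling d A D \<longleftrightarrow> (\<forall>a\<in>A. \<forall>r>0. \<exists>C. finite C \<and> C \<subseteq> A \<and> real (card C) \<le> D \<and>
      {x\<in>A. d a x \<le> r} \<subseteq> (\<Union>c\<in>C. {x\<in>A. d c x \<le> r / 2}))"

definition cinematic :: "(real^'n \<Rightarrow> real) set \<Rightarrow> real \<Rightarrow> real \<Rightarrow> (real \<Rightarrow> real) \<Rightarrow> bool" where
  "cinematic F K D \<alpha> \<longleftrightarrow>
     F \<subseteq> C2_cube \<and>
     (\<exists>h\<in>C2_cube. \<forall>f\<in>F. c2dist h f \<le> K / 2) \<and>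
     doubling c2dist F D \<and>
     (\<forall>f\<in>F. \<forall>g\<in>F. \<forall>\<xi>::real^'n. norm \<xi> = 1 \<longrightarrow>
        c2dist f g / K \<le> (INF x\<in>unit_cube. \<bar>f x - g x\<bar> + norm (grad f x - grad g x)
                                         + \<bar>dxi \<xi> f x - dxi \<xi> g x\<bar>)) \<and>
     mono_on {0..1} \<alpha> \<and> continuous_on {0..1} \<alpha> \<and> \<alpha> 0 = 0 \<and>
     (\<forall>s\<in>{0<..1}. 0 < \<alpha> s \<and> \<alpha> s \<le> s / K) \<and>
     (\<exists>\<eta>0\<in>{0<..1}. \<forall>f\<in>F. \<forall>g\<in>F. \<forall>\<xi>::real^'n. norm \<xi> = 1 \<longrightarrow>
        (\<forall>\<eta>. 0 < \<eta> \<and> \<eta> \<le> \<eta>0 \<longrightarrow> (\<forall>x\<in>unit_cube. \<forall>y\<in>unit_cube. dist x y \<le> \<alpha> \<eta> \<longrightarrow>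
           \<bar>dxi \<xi> (\<lambda>z. f z - g z) x - dxi \<xi> (\<lambda>z. f z - g z) y\<bar> \<le> \<eta>)))"

definition cinematic_family :: "(real^'n \<Rightarrow> real) set \<Rightarrow> bool" where
  "cinematic_family F \<longleftrightarrow> (\<exists>K D \<alpha>. cinematic F K D \<alpha>)"

section \<open>Furstenberg sets of hypersurfaces in R^n = R^(n-1) x R, n - 1 = CARD('n)\<close>

definition graph_cube :: "(real^'n \<Rightarrow> real) \<Rightarrow> ((real^'n) \<times> real) set" where
  "graph_cube f = {(x, f x) | x. x \<in> unit_cube}"

definition furstenberg :: "real \<Rightarrow> real \<Rightarrow> (real^'n \<Rightarrow> real) set \<Rightarrow> ((real^'n) \<times> real) set \<Rightarrow> bool" where
  "furstenberg s t F E \<longleftrightarrow>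
     F \<subseteq> C2_cube_unit \<and> cinematic_family F \<and>
     hdim c2dist F \<ge> ereal t \<and>
     (\<forall>f\<in>F. hdim dist (E \<inter> graph_cube f) \<ge> ereal s)"

end

theory Submission
  imports Defs
begin

text \<open>
  Let \<open>d\<close> be the dimension of the cube. If \<open>f\<close> and \<open>g\<close> lie in the cinematic family and
  \<open>h = f - g\<close> has norm \<open>\<rho>\<close>, then near every point where \<open>h\<close> and its gradient are small compared to \<open>\<rho>\<close>
  the gradient of \<open>h\<close> expands distances by a factor comparable to \<open>\<rho>\<close>, by the cinematic condition
  and the mean value theorem. Hence the part of \<open>{|h| \<le> \<delta>}\<close> where the gradient of \<open>h / \<rho>\<close> has size \<open>c\<close>
  lies in boundedly many balls of radius comparable to \<open>c\<close>, in which it is covered by \<open>O((c / w)^(d - 1))\<close>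
  balls of radius \<open>w = \<delta> / (\<rho> c)\<close>. Since \<open>s \<le> 1 \<le> d - 1\<close>, a discrete Frostman set of exponent
  \<open>d - 1 + s\<close> therefore has, up to a logarithm, at most a fraction \<open>(\<delta> / \<rho>)^s\<close> of its points in
  \<open>{|h| \<le> \<delta>}\<close>, exactly as for transversal curves in the plane, although graphs may be tangent.
  Given an efficient cover of \<open>E\<close>, pigeonholing isolates one scale \<open>\<delta>\<close> at which \<open>F\<close> and the sets
  \<open>E \<inter> graph f\<close> contain large discrete Frostman sets, and Cauchy-Schwarz on the incidences between the
  graphs and the covering sets bounds the number of these sets from below.
\<close>

section \<open>Hausdorff content\<close>

text \<open>\<open>E\<close> and \<open>F\<close> are arbitrary sets, so the proof uses Hausdorff
  content, which is monotone and countably subadditive on all sets, and finite point sets at one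
  scale in place of Frostman measures. Two quantities depend on \<open>f\<close>: the lower bound
  for the content of \<open>E \<inter> graph f\<close>, and the scale at which a cover of
  \<open>E\<close> captures a fair share of it. A countable decomposition of \<open>F\<close> makes
  the first uniform. Pigeonholing with weights proportional to
  \<open>\<delta> powr \<gamma>\<close>, once for each \<open>f\<close> and once for the family,
  removes the second. The weight enters the final inequality three times, because Cauchy-Schwarz
  squares the contribution of the slices. These losses, the squared logarithm and the slightly
  lowered dimensions are paid by the gap between the supposed dimension of \<open>E\<close> and the
  claimed bound. Tangency is harmless because two effects balance: where the normalised gradient has
  size c, a level set of thickness \<epsilon> has width \<epsilon> / c, but it is confined to balls
  of radius about c. The powers of c combine to c^(d - 1 - s), which is at most 1.\<close>

lemma ennreal_eq_0I: "x = 0" if "\<And>e. 0 < e \<Longrightarrow> x \<le> ennreal e"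
proof -
  have "x \<le> 0" by (rule ennreal_le_epsilon) (simp add: that)
  then show ?thesis by simp
qed

lemma ennreal_term_le_suminf: "f n \<le> (\<Sum>n. f n)" for f :: "nat \<Rightarrow> ennreal"
  using sum_le_suminf[OF summableI, of "{n}" f] by (metis finite.emptyI finite_insert sum.empty sum.insert
    add.right_neutral empty_iff zero_le)

text \<open>Hausdorff content with arbitrary upper bounds \<open>r n\<close> for the diameters.
  Covering sets may leave \<open>A\<close> and may be large, whereas \<open>hausdorff_pre\<close>
  admits only small subsets of \<open>A\<close>; this makes monotonicity immediate. As
  \<open>0 powr s = 0\<close>, pieces with \<open>r n = 0\<close> are free and serve as
  padding.\<close>

definition hcontent :: "('a \<Rightarrow> 'a \<Rightarrow> real) \<Rightarrow> real \<Rightarrow> 'a set \<Rightarrow> ennreal" where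
  "hcontent d s A =
     (INF (C, r)\<in>{(C::nat \<Rightarrow> 'a set, r). (\<forall>n. 0 \<le> r n \<and> (\<forall>x\<in>C n. \<forall>y\<in>C n. d x y \<le> r n))
        \<and> A \<subseteq> (\<Union>n. C n)}. (\<Sum>n. ennreal (r n powr s)))"

lemma hcontent_le:
  assumes "\<And>n. 0 \<le> r n" "\<And>n x y. x \<in> C n \<Longrightarrow> y \<in> C n \<Longrightarrow> d x y \<le> r n" "A \<subseteq> (\<Union>n::nat. C n)"
  shows "hcontent d s A \<le> (\<Sum>n. ennreal (r n powr s))"
  unfolding hcontent_def
  by (rule INF_lower2[of "(C, r)"]) (use assms in auto)

lemma hcontent_lessE:
  assumes "hcontent d s A < e"
  obtains C r where "\<And>n. 0 \<le> r n" "\<And>n x y. x \<in> C n \<Longrightarrow> y \<in> C n \<Longrightarrow> d x y \<le> r n"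
    "A \<subseteq> (\<Union>n::nat. C n)" "(\<Sum>n. ennreal (r n powr s)) < e"
proof -
  from assms obtain p where
    "p \<in> {(C::nat \<Rightarrow> _ set, r). (\<forall>n. 0 \<le> r n \<and> (\<forall>x\<in>C n. \<forall>y\<in>C n. d x y \<le> r n))
        \<and> A \<subseteq> (\<Union>n. C n)}" "(\<lambda>(C, r). (\<Sum>n. ennreal (r n powr s))) p < e"
    unfolding hcontent_def INF_less_iff by blast
  moreover obtain C r where "p = (C, r)" by (cases p)
  ultimately have "\<forall>n. 0 \<le> r n \<and> (\<forall>x\<in>C n. \<forall>y\<in>C n. d x y \<le> r n)" "A \<subseteq> (\<Union>n. C n)"
    "(\<Sum>n. ennreal (r n powr s)) < e" by simp_all
  then show ?thesis by (intro that[of r C]) blast+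
qed

lemma hcontent_mono:
  assumes "A \<subseteq> B" shows "hcontent d s A \<le> hcontent d s B"
  unfolding hcontent_def by (rule INF_superset_mono) (use assms in auto)

lemma hcontent_empty: "hcontent d s {} = 0"
  using hcontent_le[of "\<lambda>_. 0" "\<lambda>_. {}" d "{}" s] by simp

lemma hcontent_UN_le: "hcontent d s (\<Union>k::nat. A k) \<le> (\<Sum>k. hcontent d s (A k))"
proof (cases "\<forall>k. hcontent d s (A k) < \<infinity>")
  case False
  then obtain k where "hcontent d s (A k) = \<infinity>" by (auto simp: less_top[symmetric])
  then have "(\<Sum>k. hcontent d s (A k)) = \<infinity>"
    by (metis ennreal_suminf_lessD infinity_ennreal_def less_top order_less_irrefl)
  then show ?thesis by simp
next
  case fin: True
  show ?thesis
  proof (rule ennreal_le_epsilon)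
    fix e :: real assume e: "0 < e"
    define ek where "ek k = ennreal (e * (1/2) ^ Suc k)" for k
    have "\<exists>C r. (\<forall>n. 0 \<le> r n) \<and> (\<forall>n. \<forall>x\<in>C n. \<forall>y\<in>C n. d x y \<le> r n) \<and>
       A k \<subseteq> (\<Union>n::nat. C n) \<and> (\<Sum>n. ennreal (r n powr s)) < hcontent d s (A k) + ek k" for k
    proof -
      have "0 < ek k" using e by (simp add: ek_def)
      then have "hcontent d s (A k) < hcontent d s (A k) + ek k"
        using fin by (metis add.right_neutral ennreal_add_left_cancel_less infinity_ennreal_def less_irrefl)
      then show ?thesis by (rule hcontent_lessE) blast
    qed
    then obtain C r where *: "\<And>k n. (0::real) \<le> r k n" "\<And>k n x y. x \<in> C k n \<Longrightarrow> y \<in> C k n \<Longrightarrow> d x y \<le> r k n"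
      "\<And>k. A k \<subseteq> (\<Union>n::nat. C k n)" "\<And>k. (\<Sum>n. ennreal (r k n powr s)) < hcontent d s (A k) + ek k"
      by metis
    define C' where "C' i = (case prod_decode i of (k, n) \<Rightarrow> C k n)" for i
    define r' where "r' i = (case prod_decode i of (k, n) \<Rightarrow> r k n)" for i
    have "hcontent d s (\<Union>k. A k) \<le> (\<Sum>i. ennreal (r' i powr s))"
    proof (rule hcontent_le)
      show "(\<Union>k. A k) \<subseteq> (\<Union>n. C' n)"
      proof
        fix x assume "x \<in> (\<Union>k. A k)"
        then obtain k n where "x \<in> C k n" using *(3) by blast
        then have "x \<in> C' (prod_encode (k, n))" by (simp add: C'_def)
        then show "x \<in> (\<Union>n. C' n)" by blast
      qed
    qed (use * in \<open>auto simp: C'_def r'_def split: prod.splits\<close>)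
    also have "(\<lambda>i. ennreal (r' i powr s)) = (\<lambda>i. (\<lambda>(k, n). ennreal (r k n powr s)) (prod_decode i))"
      by (rule ext) (simp add: r'_def split: prod.splits)
    also have "suminf \<dots> = (\<Sum>k. \<Sum>n. ennreal (r k n powr s))"
      by (rule suminf_ennreal_2dimen) (simp only: prod.case)
    also have "\<dots> \<le> (\<Sum>k. hcontent d s (A k) + ek k)"
      by (intro suminf_le summableI less_imp_le *)
    also have "\<dots> = (\<Sum>k. hcontent d s (A k)) + (\<Sum>k. ek k)"
      by (rule suminf_add[symmetric]) (auto intro: summableI)
    also have "(\<Sum>k. ek k) = ennreal (\<Sum>k. e * (1/2) ^ Suc k)"
      unfolding ek_def using e by (intro suminf_ennreal2) (auto intro!: summable_mult summable_geometric)
    also have "(\<Sum>k. e * (1/2::real) ^ Suc k) = e"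
      using sums_mult[OF power_half_series, of e] by (simp only: sums_iff mult_1_right)
    finally show "hcontent d s (\<Union>k. A k) \<le> (\<Sum>k. hcontent d s (A k)) + ennreal e" .
  qed
qed

lemma hcontent_finite_le:
  assumes "finite I" "\<And>i. i \<in> I \<Longrightarrow> 0 \<le> r i"
    "\<And>i x y. i \<in> I \<Longrightarrow> x \<in> C i \<Longrightarrow> y \<in> C i \<Longrightarrow> d x y \<le> r i" "A \<subseteq> (\<Union>i\<in>I. C i)"
  shows "hcontent d s A \<le> (\<Sum>i\<in>I. ennreal (r i powr s))"
proof -
  obtain b where b: "bij_betw b {..<card I} I"
    using ex_bij_betw_nat_finite[OF assms(1)] by (auto simp: atLeast0LessThan)
  have bI: "b n \<in> I" if "n < card I" for n using b that by (auto dest: bij_betwE)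
  let ?C = "\<lambda>n. if n < card I then C (b n) else {}" and ?r = "\<lambda>n. if n < card I then r (b n) else 0"
  have "hcontent d s A \<le> (\<Sum>n. ennreal (?r n powr s))"
  proof (rule hcontent_le)
    show "A \<subseteq> (\<Union>n. ?C n)"
    proof
      fix x assume "x \<in> A"
      then obtain i where "i \<in> I" "x \<in> C i" using assms(4) by blast
      moreover then obtain n where "n < card I" "b n = i"
        using b unfolding bij_betw_def by (metis imageE lessThan_iff)
      ultimately show "x \<in> (\<Union>n. ?C n)" by (intro UN_I[of n]) auto
    qed
  qed (use assms bI in \<open>auto split: if_splits\<close>)
  also have "\<dots> = (\<Sum>n<card I. ennreal (?r n powr s))"
    by (rule suminf_finite) auto
  also have "\<dots> = (\<Sum>n<card I. ennreal (r (b n) powr s))" by simp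
  also have "\<dots> = (\<Sum>i\<in>I. ennreal (r i powr s))"
    by (rule sum.reindex_bij_betw[OF b])
  finally show ?thesis .
qed

text \<open>If the total cost of a cover is below \<open>\<delta> powr s\<close>, then so is each
  term, and every \<open>r n\<close> is at most \<open>\<delta>\<close>. Hence vanishing content
  already forces vanishing Hausdorff measure.\<close>

lemma hcontent_pos:
  assumes nn: "\<And>x y. x \<in> A \<Longrightarrow> y \<in> A \<Longrightarrow> 0 \<le> d x y" and s: "0 < s"
    and H: "hausdorff_measure d s A \<noteq> 0"
  shows "0 < hcontent d s A"
proof (rule ccontr)
  assume "\<not> 0 < hcontent d s A"
  then have 0: "hcontent d s A = 0" by (simp add: zero_less_iff_neq_zero)
  have "hausdorff_pre d s \<delta> A \<le> ennreal e" if "\<delta> > 0" "e > 0" for \<delta> e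
  proof -
    have "hcontent d s A < ennreal (min e (\<delta> powr s))" using 0 that by simp
    then obtain C r where C: "\<And>n. 0 \<le> r n" "\<And>n x y. x \<in> C n \<Longrightarrow> y \<in> C n \<Longrightarrow> d x y \<le> r n"
      "A \<subseteq> (\<Union>n::nat. C n)" "(\<Sum>n. ennreal (r n powr s)) < ennreal (min e (\<delta> powr s))"
      by (rule hcontent_lessE) blast
    have r: "r n \<le> \<delta>" for n
    proof -
      have "ennreal (r n powr s) \<le> (\<Sum>n. ennreal (r n powr s))"
        by (rule ennreal_term_le_suminf)
      with C(4) have "ennreal (r n powr s) < ennreal (\<delta> powr s)"
        by (metis (no_types, lifting) ennreal_leI min.cobounded2 order.strict_trans1 order.strict_trans2)
      then have "r n powr s < \<delta> powr s" by (simp add: ennreal_less_iff)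
      then show ?thesis using C(1)[of n] s that by (meson not_le powr_mono2 less_imp_le)
    qed
    let ?C = "\<lambda>n. C n \<inter> A"
    have "hausdorff_pre d s \<delta> A \<le> (\<Sum>n. (if ?C n = {} then 0 else hpow s (sdiam d (?C n))))"
      unfolding hausdorff_pre_def
    proof (rule INF_lower, intro CollectI conjI allI ballI)
      show "A \<subseteq> (\<Union>n. ?C n)" using C(3) by blast
      show "d x y \<le> \<delta>" if "x \<in> ?C n" "y \<in> ?C n" for n x y
        using that C(2)[of x n y] r[of n] by auto
    qed blast
    also have "\<dots> \<le> (\<Sum>n. ennreal (r n powr s))"
    proof (intro suminf_le summableI)
      fix n
      show "(if ?C n = {} then 0 else hpow s (sdiam d (?C n))) \<le> ennreal (r n powr s)"
      proof (cases "?C n = {}")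
        case False
        then obtain z where z: "z \<in> ?C n" by blast
        have in1: "(SUP y\<in>?C n. d x y) \<le> r n" if "x \<in> ?C n" for x
          by (rule cSUP_least) (use False that C(2) in auto)
        have "sdiam d (?C n) \<le> r n" unfolding sdiam_def
          by (rule cSUP_least) (use False in1 in auto)
        moreover have "0 \<le> sdiam d (?C n)"
        proof -
          have "0 \<le> d z z" using nn z by auto
          also have "\<dots> \<le> (SUP y\<in>?C n. d z y)"
            by (rule cSUP_upper) (use z C(2) in \<open>auto intro!: bdd_aboveI2\<close>)
          also have "\<dots> \<le> sdiam d (?C n)" unfolding sdiam_def
            by (rule cSUP_upper[OF z]) (use in1 in \<open>auto intro!: bdd_aboveI2\<close>)
          finally show ?thesis .
        qed
        ultimately show ?thesis using s False
          by (auto simp: hpow_def intro!: ennreal_leI powr_mono2)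
      qed simp
    qed
    also have "\<dots> \<le> ennreal e"
      using C(4) by (meson ennreal_leI less_imp_le min.cobounded1 order_trans)
    finally show ?thesis .
  qed
  then have "hausdorff_pre d s \<delta> A = 0" if "\<delta> > 0" for \<delta>
    using that ennreal_eq_0I by blast
  then have "hausdorff_measure d s A \<le> 0" unfolding hausdorff_measure_def
    by (intro SUP_least) simp
  then have "hausdorff_measure d s A = 0" by simp
  with H show False by contradiction
qed

text \<open>Pieces of diameter at most 1 allow the exponent to be raised from
  \<open>\<sigma>\<close> to \<open>s\<close>. The radii are made strictly positive because every
  covering set is later assigned a dyadic scale.\<close>

lemma null_hausdorff_coverE:
  assumes nn: "\<And>x y. x \<in> A \<Longrightarrow> y \<in> A \<Longrightarrow> 0 \<le> d x y"
    and H: "hausdorff_measure d \<sigma> A = 0" and s: "0 \<le> \<sigma>" "\<sigma> \<le> s" "0 < s" and e: "0 < e" "e \<le> 1"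
  obtains C r where "\<And>n. 0 < r n" "\<And>n x y. x \<in> C n \<Longrightarrow> y \<in> C n \<Longrightarrow> d x y \<le> r n"
    "A \<subseteq> (\<Union>n::nat. C n)" "(\<Sum>n. ennreal (r n powr s)) < ennreal e"
proof -
  have "hausdorff_pre d \<sigma> 1 A \<le> hausdorff_measure d \<sigma> A"
    unfolding hausdorff_measure_def by (rule SUP_upper) simp
  then have "hausdorff_pre d \<sigma> 1 A < ennreal (e/2)" using H e by simp
  then obtain C where C': "(\<forall>n. C n \<subseteq> A \<and> (\<forall>x\<in>C n. \<forall>y\<in>C n. d x y \<le> 1)) \<and> A \<subseteq> (\<Union>n::nat. C n)"
    and "(\<Sum>n. (if C n = {} then 0 else hpow \<sigma> (sdiam d (C n)))) < ennreal (e/2)"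
    unfolding hausdorff_pre_def INF_less_iff mem_Collect_eq by blast
  then have C: "\<And>n. C n \<subseteq> A" "\<And>n x y. x \<in> C n \<Longrightarrow> y \<in> C n \<Longrightarrow> d x y \<le> 1" "A \<subseteq> (\<Union>n::nat. C n)"
    "(\<Sum>n. (if C n = {} then 0 else hpow \<sigma> (sdiam d (C n)))) < ennreal (e/2)" (is "(\<Sum>n. ?h n) < _")
    by blast+
  define q where "q n = (if C n = {} then 0 else sdiam d (C n))" for n
  have inn: "(SUP y\<in>C n. d x y) \<le> 1" if "x \<in> C n" for x n
    by (rule cSUP_least) (use that C(2) in auto)
  have qd: "d x y \<le> q n" if "x \<in> C n" "y \<in> C n" for x y n
  proof -
    have "d x y \<le> (SUP y\<in>C n. d x y)"
      by (rule cSUP_upper) (use that C(2) in \<open>auto intro!: bdd_aboveI2\<close>)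
    also have "\<dots> \<le> sdiam d (C n)" unfolding sdiam_def
      by (rule cSUP_upper[OF that(1)]) (use inn in \<open>auto intro!: bdd_aboveI2\<close>)
    finally show ?thesis using that by (auto simp: q_def)
  qed
  have q0: "0 \<le> q n" for n
  proof (cases "C n = {}")
    case False
    then obtain x where "x \<in> C n" by blast
    then have "0 \<le> d x x" "d x x \<le> q n" using nn C(1) qd by blast+
    then show ?thesis by linarith
  qed (simp add: q_def)
  have q1: "q n \<le> 1" for n
    unfolding q_def sdiam_def by (auto intro!: cSUP_least inn)
  have hq: "ennreal (q n powr s) \<le> ?h n" for n
  proof (cases "q n = 0")
    case False
    then have "q n powr s \<le> q n powr \<sigma>" using q0[of n] q1[of n] s by (intro powr_mono') auto
    moreover have "C n \<noteq> {}" "q n = sdiam d (C n)" using False by (auto simp: q_def split: if_splits)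
    ultimately show ?thesis using False by (simp add: hpow_def ennreal_leI)
  qed simp
  \<comment> \<open>Half of \<open>e\<close> is spent on enlarging the \<open>s\<close>-th powers of
    the diameters by a geometric series, which also makes zero diameters positive.\<close>
  define r where "r n = (q n powr s + e / 2 * (1/2) ^ Suc n) powr (1 / s)" for n
  have rs: "r n powr s = q n powr s + e / 2 * (1/2) ^ Suc n" for n
    unfolding r_def using s e by (simp add: powr_powr)
  show ?thesis
  proof
    show "0 < r n" for n
    proof -
      have "0 < q n powr s + e / 2 * (1/2) ^ Suc n" using e by (intro add_nonneg_pos) auto
      then show ?thesis unfolding r_def by simp
    qed
    show "A \<subseteq> (\<Union>n. C n)" by fact
    show "d x y \<le> r n" if "x \<in> C n" "y \<in> C n" for x y n
    proof -
      have "d x y \<le> q n" using qd that by blast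
      also have "\<dots> = (q n powr s) powr (1/s)" using s q0 by (simp add: powr_powr)
      also have "\<dots> \<le> r n" unfolding r_def using s e by (intro powr_mono2) auto
      finally show ?thesis .
    qed
    have "(\<Sum>n. ennreal (r n powr s)) = (\<Sum>n. ennreal (q n powr s) + ennreal (e / 2 * (1/2) ^ Suc n))"
      using e by (simp add: rs ennreal_plus del: power_Suc)
    also have "\<dots> = (\<Sum>n. ennreal (q n powr s)) + (\<Sum>n. ennreal (e / 2 * (1/2) ^ Suc n))"
      by (rule suminf_add[symmetric]) (auto intro: summableI)
    also have "(\<Sum>n. ennreal (e / 2 * (1/2) ^ Suc n)) = ennreal (\<Sum>k. e / 2 * (1/2) ^ Suc k)"
      using e by (intro suminf_ennreal2) (auto intro!: summable_mult summable_geometric)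
    also have "(\<Sum>k. e / 2 * (1/2::real) ^ Suc k) = e / 2"
      using sums_mult[OF power_half_series, of "e / 2"] by (simp only: sums_iff mult_1_right)
    also have "(\<Sum>n. ennreal (q n powr s)) + ennreal (e/2) < ennreal (e/2) + ennreal (e/2)"
    proof -
      have "(\<Sum>n. ennreal (q n powr s)) \<le> (\<Sum>n. ?h n)"
        by (intro suminf_le summableI hq)
      with C(4) have "(\<Sum>n. ennreal (q n powr s)) < ennreal (e/2)" by (rule le_less_trans[rotated])
      then show ?thesis by (metis add.commute ennreal_add_left_cancel_less ennreal_neq_top infinity_ennreal_def)
    qed
    also have "\<dots> = ennreal e" using e by (subst ennreal_plus[symmetric]) auto
    finally show "(\<Sum>n. ennreal (r n powr s)) < ennreal e" .
  qed
qed

text \<open>Applied to the graph map, this shows that a slice of \<open>E\<close> with positive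
  content has a projection to the cube with positive content.\<close>

lemma hcontent_Lipschitz_null:
  assumes "hcontent d s A = 0" and L: "0 < L"
    and "\<And>x y. x \<in> A \<Longrightarrow> y \<in> A \<Longrightarrow> d' (\<phi> x) (\<phi> y) \<le> L * d x y"
  shows "hcontent d' s (\<phi> ` A) = 0"
proof -
  have "hcontent d' s (\<phi> ` A) \<le> ennreal e" if e: "e > 0" for e
  proof -
    have "hcontent d s A < ennreal (e / L powr s)" using assms e by simp
    then obtain C r where C: "\<And>n. 0 \<le> r n" "\<And>n x y. x \<in> C n \<Longrightarrow> y \<in> C n \<Longrightarrow> d x y \<le> r n"
      "A \<subseteq> (\<Union>n::nat. C n)" "(\<Sum>n. ennreal (r n powr s)) < ennreal (e / L powr s)"
      by (rule hcontent_lessE) blast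
    have "hcontent d' s (\<phi> ` A) \<le> (\<Sum>n. ennreal ((L * r n) powr s))"
    proof (rule hcontent_le)
      show "\<phi> ` A \<subseteq> (\<Union>n. \<phi> ` (C n \<inter> A))" using C(3) by blast
      fix n x y assume "x \<in> \<phi> ` (C n \<inter> A)" "y \<in> \<phi> ` (C n \<inter> A)"
      then obtain x' y' where xy: "x = \<phi> x'" "y = \<phi> y'" "x' \<in> C n" "y' \<in> C n" "x' \<in> A" "y' \<in> A" by blast
      have "d' x y \<le> L * d x' y'" using xy assms by simp
      also have "\<dots> \<le> L * r n" using xy C(2) L by simp
      finally show "d' x y \<le> L * r n" .
    qed (use C L in auto)
    also have "\<dots> = (\<Sum>n. ennreal (L powr s) * ennreal (r n powr s))"
      using C(1) L by (simp add: powr_mult ennreal_mult)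
    also have "\<dots> = ennreal (L powr s) * (\<Sum>n. ennreal (r n powr s))" by (simp add: ennreal_suminf_cmult)
    also have "\<dots> \<le> ennreal (L powr s) * ennreal (e / L powr s)"
      using C(4) by (intro mult_left_mono) auto
    also have "\<dots> = ennreal e" using L e by (simp add: ennreal_mult[symmetric])
    finally show ?thesis .
  qed
  then show ?thesis by (rule ennreal_eq_0I)
qed

text \<open>Otherwise subadditivity would bound the content by \<open>a\<close> times a number below
  1. The choice of \<open>w\<close> decides how much is lost at each index.\<close>

lemma hcontent_pigeonhole:
  assumes c: "ennreal a \<le> hcontent d s A" "0 < a" and A: "A \<subseteq> (\<Union>k::nat. B k)"
    and w: "\<And>k. 0 \<le> w k" "summable w" "(\<Sum>k. w k) < 1"
  shows "\<exists>k. ennreal (a * w k) \<le> hcontent d s (B k)"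
proof (rule ccontr)
  assume "\<not> ?thesis"
  then have *: "hcontent d s (B k) \<le> ennreal (a * w k)" for k
    by (meson linorder_not_le less_imp_le)
  have "ennreal a \<le> hcontent d s (\<Union>k. B k)" using c(1) hcontent_mono[OF A] order_trans by blast
  also have "\<dots> \<le> (\<Sum>k. hcontent d s (B k))" by (rule hcontent_UN_le)
  also have "\<dots> \<le> (\<Sum>k. ennreal (a * w k))" by (intro suminf_le summableI *)
  also have "\<dots> = ennreal (a * (\<Sum>k. w k))"
    using c w by (subst suminf_ennreal2) (auto simp: suminf_mult intro: summable_mult)
  finally have "a \<le> a * (\<Sum>k. w k)"
    using c w by (subst (asm) ennreal_le_iff) (auto intro!: mult_nonneg_nonneg suminf_nonneg)
  with c w show False by (metis mult.right_neutral mult_le_cancel_left_pos not_le)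
qed

section \<open>Discrete Frostman sets\<close>

text \<open>Greedy Vitali selection with cardinality in the role of the radius: take a largest set,
  discard all sets that meet it, and repeat. The empty set is excluded so that the chosen set meets,
  and thus discards, itself.\<close>

lemma disjoint_subfamily_max_card:
  assumes "finite \<S>" "{} \<notin> \<S>"
  shows "\<exists>\<D>\<subseteq>\<S>. disjoint \<D> \<and> (\<forall>S\<in>\<S>. \<exists>D\<in>\<D>. S \<inter> D \<noteq> {} \<and> card S \<le> card D)"
  using assms
proof (induction rule: finite_psubset_induct)
  case (psubset \<S>)
  show ?case
  proof (cases "\<S> = {}")
    case False
    have "\<exists>D\<in>\<S>. \<forall>S\<in>\<S>. card S \<le> card D"
    proof -
      have "Max (card ` \<S>) \<in> card ` \<S>" using psubset.hyps False by (intro Max_in) auto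
      then obtain D where "D \<in> \<S>" "Max (card ` \<S>) = card D" by blast
      then show ?thesis using psubset.hyps Max_ge[of "card ` \<S>"] by fastforce
    qed
    then obtain D where D: "D \<in> \<S>" "\<And>S. S \<in> \<S> \<Longrightarrow> card S \<le> card D" by blast
    have "D \<noteq> {}" using D psubset.prems by auto
    then have "{S \<in> \<S>. S \<inter> D = {}} \<subset> \<S>" using D by blast
    from psubset.IH[OF this] psubset.prems obtain \<D> where \<D>: "\<D> \<subseteq> {S \<in> \<S>. S \<inter> D = {}}" "disjoint \<D>"
      "\<And>S. S \<in> \<S> \<Longrightarrow> S \<inter> D = {} \<Longrightarrow> \<exists>D\<in>\<D>. S \<inter> D \<noteq> {} \<and> card S \<le> card D" by auto
    have "disjoint (insert D \<D>)"
      using \<D>(1,2) unfolding pairwise_insert disjnt_def by blast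
    moreover have "\<exists>D'\<in>insert D \<D>. S \<inter> D' \<noteq> {} \<and> card S \<le> card D'" if "S \<in> \<S>" for S
      using \<D>(3)[OF that] D(2)[OF that] by blast
    ultimately show ?thesis using D \<D>(1) by (intro exI[of _ "insert D \<D>"]) blast
  qed auto
qed

text \<open>
  The set is a subset of maximal cardinality obeying the ball condition. By maximality every point
  of \<^term>\<open>A\<close> lies in a ball on which the ball condition is almost sharp, and a Vitali selection among
  the traces of these balls on \<^term>\<open>P\<close> yields a cover of \<^term>\<open>A\<close>.
\<close>

lemma Frostman_finite_set:
  fixes d :: "'a \<Rightarrow> 'a \<Rightarrow> real"
  assumes refl: "\<And>x. x \<in> A \<Longrightarrow> d x x = 0"
    and nn: "\<And>x y. x \<in> A \<Longrightarrow> y \<in> A \<Longrightarrow> 0 \<le> d x y"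
    and sym: "\<And>x y. x \<in> A \<Longrightarrow> y \<in> A \<Longrightarrow> d x y = d y x"
    and tri: "\<And>x y z. x \<in> A \<Longrightarrow> y \<in> A \<Longrightarrow> z \<in> A \<Longrightarrow> d x z \<le> d x y + d y z"
    and bdd: "\<And>x y. x \<in> A \<Longrightarrow> y \<in> A \<Longrightarrow> d x y \<le> R"
    and s: "0 < s" and \<delta>: "0 < \<delta>" and a: "0 \<le> a" "ennreal a \<le> hcontent d s A"
  shows "\<exists>P. finite P \<and> P \<subseteq> A \<and> (\<forall>x\<in>A. \<forall>r\<ge>\<delta>. real (card {p\<in>P. d x p \<le> r}) \<le> 2 * (r / \<delta>) powr s)
    \<and> a \<le> 6 powr s * \<delta> powr s * real (card P)"
proof -
  define \<Phi> where "\<Phi> P \<longleftrightarrow> finite P \<and> P \<subseteq> A \<and>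
    (\<forall>x\<in>A. \<forall>r\<ge>\<delta>. real (card {p\<in>P. d x p \<le> r}) \<le> 2 * (r / \<delta>) powr s)" for P
  \<comment> \<open>A ball of radius \<open>max R \<delta>\<close> around a point of the set
    contains all of it, so admissible sets have bounded size and a largest one exists.\<close>
  define b where "b = nat \<lceil>2 * (max R \<delta> / \<delta>) powr s\<rceil>"
  have "card P \<le> b" if "\<Phi> P" for P
  proof (cases "P = {}")
    case False
    have PA: "P \<subseteq> A" using that unfolding \<Phi>_def by (elim conjE)
    obtain x where x: "x \<in> P" "x \<in> A" using False PA by auto
    have "{p\<in>P. d x p \<le> max R \<delta>} = P" 
      using bdd[OF x(2)] PA by (auto simp: le_max_iff_disj)
    then have "real (card P) \<le> 2 * (max R \<delta> / \<delta>) powr s"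
      using that x unfolding \<Phi>_def by (metis max.cobounded2)
    then show ?thesis unfolding b_def by linarith
  qed simp
  moreover have "\<Phi> {}" by (simp add: \<Phi>_def)
  ultimately obtain P where P: "\<Phi> P" "\<And>P'. \<Phi> P' \<Longrightarrow> card P' \<le> card P"
    using ex_has_greatest_nat[of \<Phi> "{}" card "Suc b"] by (metis less_Suc_eq_le)
  have finP: "finite P" and PA: "P \<subseteq> A"
    and ball: "\<And>x r. x \<in> A \<Longrightarrow> \<delta> \<le> r \<Longrightarrow> real (card {p\<in>P. d x p \<le> r}) \<le> 2 * (r / \<delta>) powr s"
    using P(1) unfolding \<Phi>_def by auto
  define G where "G x y r \<longleftrightarrow> y \<in> A \<and> \<delta> \<le> r \<and> d y x \<le> r \<and> {p\<in>P. d y p \<le> r} \<noteq> {} \<and>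
    (r / \<delta>) powr s \<le> card {p\<in>P. d y p \<le> r}" for x y r
  have "\<exists>y r. G x y r" if x: "x \<in> A" for x
  proof (cases "x \<in> P")
    case True
    have "{p\<in>P. d x p \<le> \<delta>} \<noteq> {}" using True refl x \<delta> by (auto intro!: exI[of _ x])
    moreover then have "1 \<le> card {p\<in>P. d x p \<le> \<delta>}"
      using finP by (simp add: Suc_le_eq card_gt_0_iff)
    ultimately show ?thesis unfolding G_def using x refl \<delta> by (intro exI[of _ x] exI[of _ \<delta>] conjI) simp_all
  next
    case False
    then have "\<not> \<Phi> (insert x P)" using P(2)[of "insert x P"] finP by auto
    then obtain y r where y: "y \<in> A" "\<delta> \<le> r"
      and gt: "2 * (r / \<delta>) powr s < real (card {p\<in>insert x P. d y p \<le> r})"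
      unfolding \<Phi>_def using finP PA x by (auto simp: not_le)
    have ge1: "1 \<le> (r / \<delta>) powr s" using y \<delta> s by (intro ge_one_powr_ge_zero) auto
    have dyx: "d y x \<le> r"
    proof (rule ccontr)
      assume "\<not> d y x \<le> r"
      then have "{p\<in>insert x P. d y p \<le> r} = {p\<in>P. d y p \<le> r}" by auto
      with gt ball[OF y] show False by simp
    qed
    then have "{p\<in>insert x P. d y p \<le> r} = insert x {p\<in>P. d y p \<le> r}" by auto
    then have "card {p\<in>insert x P. d y p \<le> r} = Suc (card {p\<in>P. d y p \<le> r})"
      using False finP by simp
    \<comment> \<open>The violating count includes the new point. Without it more than
      \<open>2 * X - 1\<close>, hence at least \<open>X\<close>, points remain, where
      \<open>X = (r / \<delta>) powr s \<ge> 1\<close>. This is the reason for the factor 2 in the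
      ball condition.\<close>
    with gt ge1 have le: "(r / \<delta>) powr s \<le> card {p\<in>P. d y p \<le> r}" by simp
    with ge1 have "{p\<in>P. d y p \<le> r} \<noteq> {}" by (metis card.empty not_one_le_zero of_nat_0 of_nat_1 of_nat_le_iff order_trans)
    with y dyx le show ?thesis unfolding G_def by blast
  qed
  then obtain Y r where G: "\<And>x. x \<in> A \<Longrightarrow> G x (Y x) (r x)" by metis
  have Yr: "\<And>x. x \<in> A \<Longrightarrow> Y x \<in> A" "\<And>x. x \<in> A \<Longrightarrow> \<delta> \<le> r x" "\<And>x. x \<in> A \<Longrightarrow> d (Y x) x \<le> r x"
    "\<And>x. x \<in> A \<Longrightarrow> {p\<in>P. d (Y x) p \<le> r x} \<noteq> {}"
    "\<And>x. x \<in> A \<Longrightarrow> (r x / \<delta>) powr s \<le> card {p\<in>P. d (Y x) p \<le> r x}"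
    using G unfolding G_def by simp_all
  define S where "S x = {p\<in>P. d (Y x) p \<le> r x}" for x
  \<comment> \<open>The radius that cardinality alone certifies. It is monotone in the cardinality,
    so selection by size acts as selection by radius, and \<open>\<rho> T powr s\<close> is a
    multiple of \<open>card T\<close>, hence additive over disjoint sets.\<close>
  define \<rho> where "\<rho> T = \<delta> * real (card T) powr (1/s)" for T :: "'a set"
  have \<rho>_mono: "\<rho> T \<le> \<rho> T'" if "card T \<le> card T'" for T T' :: "'a set"
    unfolding \<rho>_def using that s \<delta> by (intro mult_left_mono powr_mono2) auto
  have r\<rho>: "r x \<le> \<rho> (S x)" if "x \<in> A" for x
  proof -
    have "r x / \<delta> = ((r x / \<delta>) powr s) powr (1/s)"
      using Yr(2)[OF that] s \<delta> by (simp add: powr_powr)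
    also have "\<dots> \<le> real (card (S x)) powr (1/s)"
      using Yr(5)[OF that] s unfolding S_def by (intro powr_mono2) auto
    finally show ?thesis using \<delta> unfolding \<rho>_def by (simp add: field_simps)
  qed
  have SA: "p \<in> A" if "p \<in> S x" for p x using that PA by (auto simp: S_def)
  have Sx: "d x p \<le> 2 * \<rho> (S x)" if "x \<in> A" "p \<in> S x" for x p
    using tri[of x "Y x" p] sym[of x "Y x"] Yr(1,3)[OF that(1)] r\<rho>[OF that(1)] that SA[OF that(2)]
    by (auto simp: S_def)
  have SS: "d p q \<le> 2 * \<rho> (S x)" if "x \<in> A" "p \<in> S x" "q \<in> S x" for x p q
    using tri[of p "Y x" q] sym[of p "Y x"] Yr(1)[OF that(1)] r\<rho>[OF that(1)] that SA[of _ x]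
    by (auto simp: S_def)
  have finS: "finite (S ` A)" by (rule finite_subset[of _ "Pow P"]) (use finP in \<open>auto simp: S_def\<close>)
  moreover have "{} \<notin> S ` A" using Yr(4) unfolding S_def by blast
  ultimately obtain \<D> where \<D>: "\<D> \<subseteq> S ` A" "disjoint \<D>"
    "\<And>T. T \<in> S ` A \<Longrightarrow> \<exists>D\<in>\<D>. T \<inter> D \<noteq> {} \<and> card T \<le> card D"
    using disjoint_subfamily_max_card by (metis (no_types, lifting))
  have fin\<D>: "finite \<D>" using \<D>(1) finS finite_subset by blast
  \<comment> \<open>Three moves of length at most \<open>2 * \<rho> D\<close> lead from
    \<open>x\<close> to a point of \<open>S x \<inter> D\<close>, across \<open>D\<close> to a point
    of \<open>S y\<close>, and on to \<open>y\<close>; hence the factor 6.\<close>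
  have "hcontent d s A \<le> (\<Sum>D\<in>\<D>. ennreal ((6 * \<rho> D) powr s))"
  proof (rule hcontent_finite_le[OF fin\<D>])
    show "0 \<le> 6 * \<rho> D" for D using \<delta> by (simp add: \<rho>_def)
    show "A \<subseteq> (\<Union>D\<in>\<D>. {x\<in>A. S x \<inter> D \<noteq> {} \<and> card (S x) \<le> card D})" using \<D>(3) by blast
    fix D x y assume D: "D \<in> \<D>" and x: "x \<in> {x\<in>A. S x \<inter> D \<noteq> {} \<and> card (S x) \<le> card D}"
      and y: "y \<in> {x\<in>A. S x \<inter> D \<noteq> {} \<and> card (S x) \<le> card D}"
    then obtain p q z where pq: "p \<in> S x" "p \<in> D" "q \<in> S y" "q \<in> D" "z \<in> A" "D = S z" using \<D>(1) by blast
    have A: "x \<in> A" "y \<in> A" "p \<in> A" "q \<in> A" using x y pq SA by auto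
    have "d x y \<le> d x p + d p y" "d p y \<le> d p q + d q y" "d q y = d y q"
      using tri[OF A(1,3,2)] tri[OF A(3,4,2)] sym[OF A(4,2)] by simp_all
    moreover have "d x p \<le> 2 * \<rho> (S x)" "d y q \<le> 2 * \<rho> (S y)" "d p q \<le> 2 * \<rho> D"
      using Sx SS pq A by auto
    moreover have "\<rho> (S x) \<le> \<rho> D" "\<rho> (S y) \<le> \<rho> D" using \<rho>_mono x y by auto
    ultimately show "d x y \<le> 6 * \<rho> D" by linarith
  qed
  also have "\<dots> = ennreal (\<Sum>D\<in>\<D>. (6 * \<rho> D) powr s)" by (simp add: sum_ennreal)
  finally have "a \<le> (\<Sum>D\<in>\<D>. (6 * \<rho> D) powr s)"
    using a by (meson ennreal_le_iff order_trans sum_nonneg powr_ge_zero)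
  also have "\<dots> = (\<Sum>D\<in>\<D>. 6 powr s * \<delta> powr s * real (card D))"
    using s \<delta> by (simp add: \<rho>_def powr_mult powr_powr mult.assoc)
  also have "\<dots> = 6 powr s * \<delta> powr s * real (\<Sum>D\<in>\<D>. card D)"
    by (simp add: sum_distrib_left)
  also have "(\<Sum>D\<in>\<D>. card D) = card (\<Union>\<D>)"
    using \<D>(1,2) finP finite_subset[of _ P] unfolding S_def by (intro card_Union_disjoint[symmetric]) auto
  also have "real (card (\<Union>\<D>)) \<le> real (card P)"
    using \<D>(1) finP by (intro of_nat_mono card_mono) (auto simp: S_def)
  finally have "a \<le> 6 powr s * \<delta> powr s * real (card P)"
    by (simp add: mult_left_mono)
  then show ?thesis using finP PA ball by blast
qed

section \<open>Counting points near a nondegenerate zero set\<close>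

lemma card_le_image_times_fibre:
  fixes M :: real
  assumes "finite Z" and "0 \<le> M" and "\<And>p. p \<in> Z \<Longrightarrow> real (card {q\<in>Z. l q = l p}) \<le> M"
  shows "real (card Z) \<le> real (card (l ` Z)) * M"
proof -
  have "Z = (\<Union>t\<in>l ` Z. {q\<in>Z. l q = t})" by auto
  then have "card Z \<le> (\<Sum>t\<in>l ` Z. card {q\<in>Z. l q = t})"
    using card_UN_le[of "l ` Z" "\<lambda>t. {q\<in>Z. l q = t}"] assms(1) by simp
  then have "real (card Z) \<le> (\<Sum>t\<in>l ` Z. real (card {q\<in>Z. l q = t}))"
    by (simp flip: of_nat_sum)
  also have "\<dots> \<le> (\<Sum>t\<in>l ` Z. M)" using assms(3) by (intro sum_mono) auto
  finally show ?thesis by simp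
qed

text \<open>Only the coordinates in \<open>J\<close> are subdivided. The others collapse to 0, so
  that cells may be long strips along an omitted coordinate and the exponent in their number is
  \<open>card J\<close>.\<close>

definition grid_cell :: "'n set \<Rightarrow> real \<Rightarrow> real^'n \<Rightarrow> 'n \<Rightarrow> int" where
  "grid_cell J \<eta> p j = (if j \<in> J then \<lfloor>p $ j / \<eta>\<rfloor> else 0)"

lemma grid_cell_eqD:
  assumes "grid_cell J \<eta> p = grid_cell J \<eta> q" "0 < \<eta>" "j \<in> J"
  shows "\<bar>p $ j - q $ j\<bar> \<le> \<eta>"
proof -
  have "\<lfloor>p $ j / \<eta>\<rfloor> = \<lfloor>q $ j / \<eta>\<rfloor>"
    using assms(1,3) by (auto simp: grid_cell_def dest!: fun_cong[of _ _ j])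
  then have "\<bar>p $ j / \<eta> - q $ j / \<eta>\<bar> \<le> 1" by linarith
  then show ?thesis using assms(2) by (simp add: diff_divide_distrib[symmetric] abs_divide)
qed

lemma card_grid_cells_le:
  fixes Z :: "(real^'n) set"
  assumes Z: "finite Z" and \<eta>: "0 < \<eta>" and b: "0 \<le> b" "\<And>x y j. x \<in> Z \<Longrightarrow> y \<in> Z \<Longrightarrow> \<bar>x $ j - y $ j\<bar> \<le> b"
  shows "real (card (grid_cell J \<eta> ` Z)) \<le> (b / \<eta> + 2) ^ card J"
proof -
  define lo where "lo j = Min ((\<lambda>p. \<lfloor>p $ j / \<eta>\<rfloor>) ` Z)" for j
  define T where "T j = (if j \<in> J then {lo j..lo j + \<lfloor>b / \<eta>\<rfloor> + 1} else {0})" for j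
  have "grid_cell J \<eta> p j \<in> T j" if p: "p \<in> Z" for p j
  proof (cases "j \<in> J")
    case True
    have "lo j \<in> (\<lambda>p. \<lfloor>p $ j / \<eta>\<rfloor>) ` Z" unfolding lo_def using Z p by (intro Min_in) auto
    then obtain q where q: "q \<in> Z" "lo j = \<lfloor>q $ j / \<eta>\<rfloor>" by blast
    have "lo j \<le> \<lfloor>p $ j / \<eta>\<rfloor>" unfolding lo_def using Z p by (intro Min_le) auto
    moreover have "p $ j / \<eta> \<le> q $ j / \<eta> + b / \<eta>"
      using b(2)[OF p q(1), of j] \<eta> by (simp add: add_divide_distrib[symmetric] divide_right_mono)
    then have "\<lfloor>p $ j / \<eta>\<rfloor> \<le> lo j + \<lfloor>b / \<eta>\<rfloor> + 1" unfolding q(2) by linarith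
    ultimately show ?thesis using True by (simp add: T_def grid_cell_def)
  qed (simp add: T_def grid_cell_def)
  then have sub: "grid_cell J \<eta> ` Z \<subseteq> PiE UNIV T" by auto
  have fin: "finite (PiE UNIV T)" by (rule finite_PiE) (auto simp: T_def)
  have "0 \<le> \<lfloor>b / \<eta>\<rfloor>" using b \<eta> by simp
  then have cT: "real (card (T j)) \<le> (if j \<in> J then b / \<eta> + 2 else 1)" for j
    unfolding T_def by auto
  have "real (card (grid_cell J \<eta> ` Z)) \<le> real (card (PiE UNIV T))"
    using card_mono[OF fin sub] by simp
  also have "\<dots> = (\<Prod>j\<in>UNIV. real (card (T j)))" by (simp add: card_PiE)
  also have "\<dots> \<le> (\<Prod>j\<in>UNIV. if j \<in> J then b / \<eta> + 2 else 1)"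
    using cT by (intro prod_mono) auto
  also have "\<dots> = (b / \<eta> + 2) ^ card J"
    by (simp add: prod.If_cases)
  finally show ?thesis .
qed

lemma norm_le_card_times:
  fixes x :: "real^'n"
  assumes "\<And>j. \<bar>x $ j\<bar> \<le> b" shows "norm x \<le> real CARD('n) * b"
proof -
  have "norm x \<le> (\<Sum>j\<in>UNIV. \<bar>x $ j\<bar>)" by (rule norm_le_l1_cart)
  also have "\<dots> \<le> (\<Sum>j\<in>(UNIV::'n set). b)" by (intro sum_mono assms)
  finally show ?thesis by simp
qed

lemma dyadic_scale:
  assumes "0 < x" "x \<le> (1::real)"
  shows "\<exists>l. (1/2) ^ Suc l < x \<and> x \<le> (1/2) ^ l"
proof -
  have ex: "\<exists>n. (1/2::real) ^ n < x" using real_arch_pow_inv[OF assms(1), of "1/2"] by auto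
  define n where "n = (LEAST n. (1/2::real) ^ n < x)"
  have n: "(1/2) ^ n < x" unfolding n_def by (rule LeastI_ex[OF ex])
  with assms have "n \<noteq> 0" by (cases n) auto
  then obtain l where l: "n = Suc l" by (cases n) auto
  have "\<not> (1/2) ^ l < x" using not_less_Least[of l "\<lambda>n. (1/2::real) ^ n < x"] l unfolding n_def by auto
  then show ?thesis using n l by (intro exI[of _ l]) auto
qed

text \<open>Here \<open>h\<close> stands for the difference of two members of the family divided by
  its C2 norm, and \<open>g\<close> for the gradient of \<open>h\<close>. Expansion by
  \<open>lam\<close> is asked only for points within \<open>r1\<close> of each other at which
  \<open>h\<close> and \<open>g\<close> are at most \<open>c1\<close>, since the cinematic condition
  yields it only there.\<close>

locale nondegenerate =
  fixes Q :: "(real^'n) set" and h :: "real^'n \<Rightarrow> real" and g :: "real^'n \<Rightarrow> real^'n" and lam r1 c1 dm :: real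
  assumes mvt: "x \<in> Q \<Longrightarrow> y \<in> Q \<Longrightarrow> \<exists>z\<in>Q. norm (z - x) \<le> norm (y - x) \<and> h x - h y = g z \<bullet> (x - y)"
    and lip: "x \<in> Q \<Longrightarrow> y \<in> Q \<Longrightarrow> norm (g x - g y) \<le> norm (x - y)"
    and g_le_1: "x \<in> Q \<Longrightarrow> norm (g x) \<le> 1"
    and nondeg: "x \<in> Q \<Longrightarrow> y \<in> Q \<Longrightarrow> norm (x - y) \<le> r1 \<Longrightarrow> \<bar>h x\<bar> \<le> c1 \<Longrightarrow> \<bar>h y\<bar> \<le> c1 \<Longrightarrow>
      norm (g x) \<le> c1 \<Longrightarrow> norm (g y) \<le> c1 \<Longrightarrow> lam * norm (x - y) \<le> norm (g x - g y)"
    and width: "x \<in> Q \<Longrightarrow> y \<in> Q \<Longrightarrow> \<bar>x $ j - y $ j\<bar> \<le> 1"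
    and pos: "0 < lam" "0 < r1" "0 < c1" "c1 \<le> 1"
    and dm: "dm = real CARD('n)"
begin

lemma dm_ge_1: "1 \<le> dm" by (simp add: dm Suc_le_eq)

lemma norm_le_dm: "norm x \<le> dm * b" if "\<And>j. \<bar>x $ j\<bar> \<le> b" for x :: "real^'n"
  using norm_le_card_times[OF that] by (simp add: dm)

text \<open>The first entry comes from expansion, \<open>lam * norm (x - y) \<le> 2 * c\<close>. The
  second makes the trivial diameter bound \<open>dm\<close> suffice when
  \<open>c > c1\<close>.\<close>

definition "B = max (2 / lam) (dm / c1)"

lemma B_ge_1: "1 \<le> B"
proof -
  have "1 \<le> dm / c1" using pos dm_ge_1 by (simp add: field_simps)
  then show ?thesis unfolding B_def by linarith
qed

text \<open>Gradients of size at most \<open>c\<close> differ by at most \<open>2 * c\<close>, and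
  expansion turns this into closeness of the points. The condition
  \<open>\<epsilon> \<le> c\<^sup>2\<close> gives \<open>\<epsilon> \<le> c\<close>, so the values
  of \<open>h\<close> are below \<open>c1\<close> whenever \<open>c\<close> is.\<close>

lemma near_critical_diam:
  assumes "x \<in> Q" "y \<in> Q" "norm (x - y) \<le> r1" "\<bar>h x\<bar> \<le> \<epsilon>" "\<bar>h y\<bar> \<le> \<epsilon>" "norm (g x) \<le> c" "norm (g y) \<le> c"
    "0 < c" "c \<le> 1" "\<epsilon> \<le> c\<^sup>2"
  shows "norm (x - y) \<le> B * c"
proof (cases "c \<le> c1")
  case True
  have "\<epsilon> \<le> c" using assms(8-10) by (smt (verit) power2_eq_square mult_left_le)
  then have "lam * norm (x - y) \<le> norm (g x - g y)" using assms True by (intro nondeg) auto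
  also have "\<dots> \<le> 2 * c" using assms norm_triangle_ineq4[of "g x" "g y"] by linarith
  finally have "norm (x - y) \<le> 2 / lam * c" using pos by (simp add: field_simps)
  also have "\<dots> \<le> B * c" using assms by (intro mult_right_mono) (auto simp: B_def)
  finally show ?thesis .
next
  case False
  have "norm (x - y) \<le> dm * 1" by (rule norm_le_dm) (use width assms in auto)
  also have "\<dots> \<le> dm / c1 * c" using False pos dm_ge_1 by (simp add: field_simps)
  also have "\<dots> \<le> B * c" using assms by (intro mult_right_mono) (auto simp: B_def)
  finally show ?thesis .
qed

text \<open>A quantitative implicit function theorem: near \<open>p\<close> the \<open>i\<close>-th
  partial derivative keeps size at least \<open>c / (4 * dm)\<close>, so the small changes of
  \<open>h\<close> and of the other coordinates bound the change of coordinate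
  \<open>i\<close>.\<close>

lemma transversal_diam:
  assumes p: "p \<in> Q" and q: "q \<in> Q" and h: "\<bar>h p\<bar> \<le> \<epsilon>" "\<bar>h q\<bar> \<le> \<epsilon>" and c: "0 < c" "norm (g p) \<le> c"
    and i: "c / (2 * dm) \<le> \<bar>g p $ i\<bar>" and near: "norm (p - q) \<le> c / (4 * dm)"
    and j: "\<And>j. j \<noteq> i \<Longrightarrow> \<bar>p $ j - q $ j\<bar> \<le> \<epsilon> / c"
  shows "norm (p - q) \<le> (8 * dm * (1 + dm) + dm) * dm * (\<epsilon> / c)"
proof -
  obtain z where z: "z \<in> Q" "norm (z - p) \<le> norm (q - p)" "h p - h q = g z \<bullet> (p - q)"
    using mvt p q by blast
  \<comment> \<open>The point \<open>z\<close> is no further from \<open>p\<close> than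
    \<open>q\<close> is, so the Lipschitz bound costs at most half of the lower bound
    \<open>c / (2 * dm)\<close> known at \<open>p\<close>.\<close>
  have "norm (g z - g p) \<le> c / (4 * dm)" using lip[OF z(1) p] z(2) near by (simp add: norm_minus_commute)
  moreover have c4: "c / (4 * dm) \<le> c" using c dm_ge_1 by (simp add: field_simps)
  moreover have "\<bar>(g z - g p) $ i\<bar> \<le> norm (g z - g p)" by (rule component_le_norm_cart)
  moreover have "c / (2 * dm) = c / (4 * dm) + c / (4 * dm)" using dm_ge_1 by (simp add: field_simps)
  ultimately have gi: "c / (4 * dm) \<le> \<bar>g z $ i\<bar>" and gz: "norm (g z) \<le> 2 * c"
    using i c norm_triangle_ineq2[of "g z" "g p"] by auto
  have \<epsilon>: "0 \<le> \<epsilon>" using h by linarith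
  have "g z \<bullet> (p - q) = (\<Sum>j\<in>UNIV. g z $ j * (p $ j - q $ j))" by (simp add: inner_vec_def)
  also have "\<dots> = g z $ i * (p $ i - q $ i) + (\<Sum>j\<in>UNIV - {i}. g z $ j * (p $ j - q $ j))"
    by (subst sum.remove[of _ i]) auto
  finally have "g z $ i * (p $ i - q $ i) = (h p - h q) - (\<Sum>j\<in>UNIV - {i}. g z $ j * (p $ j - q $ j))"
    using z by simp
  moreover have "\<bar>\<Sum>j\<in>UNIV - {i}. g z $ j * (p $ j - q $ j)\<bar> \<le> (\<Sum>j\<in>UNIV - {i}. 2 * \<epsilon>)"
  proof (intro order_trans[OF sum_abs] sum_mono)
    fix j' assume "j' \<in> UNIV - {i}"
    then have "\<bar>g z $ j'\<bar> * \<bar>p $ j' - q $ j'\<bar> \<le> (2 * c) * (\<epsilon> / c)"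
      using component_le_norm_cart[of "g z" j'] gz c j by (intro mult_mono) auto
    then show "\<bar>g z $ j' * (p $ j' - q $ j')\<bar> \<le> 2 * \<epsilon>" using c by (simp add: abs_mult)
  qed
  moreover have "(\<Sum>j\<in>UNIV - {i}. 2 * \<epsilon>) \<le> 2 * dm * \<epsilon>"
    using \<epsilon> by (simp add: dm card_Diff_singleton algebra_simps mult_right_mono)
  ultimately have "\<bar>g z $ i * (p $ i - q $ i)\<bar> \<le> 2 * (1 + dm) * \<epsilon>" using h by (simp add: algebra_simps)
  moreover have "c / (4 * dm) * \<bar>p $ i - q $ i\<bar> \<le> \<bar>g z $ i\<bar> * \<bar>p $ i - q $ i\<bar>"
    using gi by (intro mult_right_mono) auto
  ultimately have "c / (4 * dm) * \<bar>p $ i - q $ i\<bar> \<le> 2 * (1 + dm) * \<epsilon>" by (simp add: abs_mult)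
  then have "\<bar>p $ i - q $ i\<bar> \<le> 8 * dm * (1 + dm) * (\<epsilon> / c)"
    using c dm_ge_1 by (simp add: field_simps)
  moreover have "0 \<le> 8 * dm * (1 + dm) * (\<epsilon> / c)" "0 \<le> dm * (\<epsilon> / c)" "\<epsilon> / c \<le> dm * (\<epsilon> / c)"
    using c \<epsilon> dm_ge_1 mult_right_mono[of 1 dm "\<epsilon> / c"] by (auto intro!: mult_nonneg_nonneg divide_nonneg_pos)
  ultimately have all: "\<bar>p $ j' - q $ j'\<bar> \<le> 8 * dm * (1 + dm) * (\<epsilon> / c) + dm * (\<epsilon> / c)" for j'
  proof (cases "j' = i")
    case False
    from j[OF this] \<open>\<epsilon> / c \<le> dm * (\<epsilon> / c)\<close> \<open>0 \<le> 8 * dm * (1 + dm) * (\<epsilon> / c)\<close> show ?thesis by linarith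
  qed simp
  have "\<bar>(p - q) $ j'\<bar> \<le> (8 * dm * (1 + dm) + dm) * (\<epsilon> / c)" for j'
    using all[of j'] by (simp only: distrib_right[of "8 * dm * (1 + dm)"] vector_minus_component)
  from norm_le_dm[OF this] show ?thesis by (simp add: mult_ac)
qed

definition "C1 = (8 * dm * (1 + dm) + dm) * dm"

lemma C1_ge_1: "1 \<le> C1"
proof -
  have "1 * 1 \<le> (8 * dm * (1 + dm) + dm) * dm"
    using dm_ge_1 by (intro mult_mono add_increasing) auto
  then show ?thesis by (simp add: C1_def)
qed

text \<open>\<open>P\<close> is a discrete Frostman set of exponent \<open>m\<close> at scale
  \<open>\<delta>\<close>, and \<open>\<epsilon>\<close> is the thickness of the neighbourhood of
  the zero set. For a pair at distance \<open>\<rho>\<close> it will be a constant times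
  \<open>\<delta> / \<rho>\<close>.\<close>

context
  fixes P :: "(real^'n) set" and \<delta> m \<epsilon> :: real
  assumes P: "finite P" "P \<subseteq> Q" and \<delta>: "0 < \<delta>" "\<delta> \<le> \<epsilon>" and \<epsilon>: "\<epsilon> \<le> 1" and m: "0 < m"
    and ball: "\<And>x r. x \<in> P \<Longrightarrow> \<delta> \<le> r \<Longrightarrow> real (card {p\<in>P. dist x p \<le> r}) \<le> 2 * (r / \<delta>) powr m"
begin

lemma card_near_le:
  assumes "p \<in> P" "\<delta> \<le> r" "Z \<subseteq> P" "\<And>q. q \<in> Z \<Longrightarrow> norm (p - q) \<le> r"
  shows "real (card Z) \<le> 2 * (r / \<delta>) powr m"
proof -
  have "card Z \<le> card {q\<in>P. dist p q \<le> r}"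
    using assms P by (intro card_mono) (auto simp: dist_norm)
  then show ?thesis using ball[OF assms(1,2)] by linarith
qed

text \<open>Expansion is available only at distances up to \<open>r1\<close>. Grid cells of side
  \<open>r1 / dm\<close> have diameter at most \<open>r1\<close>, and boundedly many of them meet
  \<open>Q\<close>.\<close>

lemma card_cells_le:
  assumes Z: "Z \<subseteq> P" and M: "0 \<le> M"
    and *: "\<And>Z'. Z' \<subseteq> Z \<Longrightarrow> (\<And>x y. x \<in> Z' \<Longrightarrow> y \<in> Z' \<Longrightarrow> norm (x - y) \<le> r1) \<Longrightarrow> real (card Z') \<le> M"
  shows "real (card Z) \<le> (dm / r1 + 2) ^ CARD('n) * M"
proof -
  define l where "l = grid_cell (UNIV::'n set) (r1 / dm)"
  have fin: "finite Z" using Z P finite_subset by blast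
  have \<eta>: "0 < r1 / dm" using pos dm_ge_1 by simp
  have "real (card Z) \<le> real (card (l ` Z)) * M"
  proof (rule card_le_image_times_fibre[OF fin M])
    fix p assume "p \<in> Z"
    have "norm (x - y) \<le> r1" if "l x = l y" for x y
    proof -
      have "norm (x - y) \<le> dm * (r1 / dm)"
        using grid_cell_eqD[OF that[unfolded l_def] \<eta>] by (intro norm_le_dm) auto
      then show ?thesis using dm_ge_1 by simp
    qed
    then show "real (card {q \<in> Z. l q = l p}) \<le> M" by (intro *) auto
  qed
  also have "\<dots> \<le> (dm / r1 + 2) ^ CARD('n) * M"
  proof (rule mult_right_mono[OF _ M])
    show "real (card (l ` Z)) \<le> (dm / r1 + 2) ^ CARD('n)"
    proof -
      have "real (card (l ` Z)) \<le> (1 / (r1 / dm) + 2) ^ card (UNIV :: 'n set)"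
        unfolding l_def using width subsetD[OF order_trans[OF Z P(2)]]
        by (intro card_grid_cells_le[OF fin \<eta>]) auto
      then show ?thesis by simp
    qed
  qed
  finally show ?thesis .
qed

text \<open>The threshold \<open>sqrt \<epsilon>\<close> is the smallest \<open>c\<close> with
  \<open>\<epsilon> \<le> c\<^sup>2\<close>. At this size the width \<open>\<epsilon> / c\<close>
  equals \<open>c\<close>, so the points of one cell are counted in a single ball without further
  subdivision.\<close>

lemma card_critical_le:
  "real (card {p\<in>P. \<bar>h p\<bar> \<le> \<epsilon> \<and> norm (g p) \<le> sqrt \<epsilon>})
     \<le> (dm / r1 + 2) ^ CARD('n) * (2 * (B * sqrt \<epsilon> / \<delta>) powr m)"
proof (rule card_cells_le)
  fix Z assume Z: "Z \<subseteq> {p\<in>P. \<bar>h p\<bar> \<le> \<epsilon> \<and> norm (g p) \<le> sqrt \<epsilon>}"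
    and close: "\<And>x y. x \<in> Z \<Longrightarrow> y \<in> Z \<Longrightarrow> norm (x - y) \<le> r1"
  show "real (card Z) \<le> 2 * (B * sqrt \<epsilon> / \<delta>) powr m"
  proof (cases "Z = {}")
    case False
    then obtain p where p: "p \<in> Z" by blast
    have "norm (p - q) \<le> B * sqrt \<epsilon>" if "q \<in> Z" for q
      using that p Z P close \<delta> \<epsilon> by (intro near_critical_diam[of _ _ \<epsilon>]) auto
    moreover have "\<delta> \<le> B * sqrt \<epsilon>"
    proof -
      have "\<epsilon> \<le> sqrt \<epsilon>" using \<delta> \<epsilon> by (intro real_le_rsqrt) (simp add: power2_eq_square mult_left_le)
      also have "\<dots> \<le> B * sqrt \<epsilon>" using B_ge_1 \<delta> by (simp add: mult_le_cancel_right1)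
      finally show ?thesis using \<delta> by linarith
    qed
    ultimately show ?thesis using p Z by (intro card_near_le[of p]) auto
  qed simp
qed auto

text \<open>Nested pigeonholing, one factor per level: cells of diameter \<open>r1\<close>; a
  coordinate in which the gradient is large (\<open>dm\<close> choices); cells of side comparable to
  \<open>c\<close>, on which that partial derivative is stable; cells of side
  \<open>\<epsilon> / c\<close> in the other coordinates. What remains lies in a ball of radius
  \<open>C1 * (\<epsilon> / c)\<close>. The power of \<open>c\<^sup>2 / \<epsilon>\<close> reflects
  the number of such balls along a hypersurface patch of diameter comparable to
  \<open>c\<close>.\<close>

lemma card_scale_le:
  assumes c: "0 < c" "c \<le> 1" "\<epsilon> \<le> c\<^sup>2"
  shows "real (card {p\<in>P. \<bar>h p\<bar> \<le> \<epsilon> \<and> c / 2 < norm (g p) \<and> norm (g p) \<le> c})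
     \<le> (dm / r1 + 2) ^ CARD('n) * (dm * ((4 * dm\<^sup>2 * B + 2) ^ CARD('n) *
         (((B + 2) * (c\<^sup>2 / \<epsilon>)) ^ (CARD('n) - 1) * (2 * (C1 * (\<epsilon> / c) / \<delta>) powr m))))"
    (is "_ \<le> _ * (dm * (?N1 * (?N2 * ?N3)))")
proof (rule card_cells_le)
  have \<epsilon>0: "0 < \<epsilon>" using \<delta> by linarith
  have B0: "0 < B" using B_ge_1 by linarith
  have N2: "0 \<le> ?N2" using B0 \<epsilon>0 by simp
  have N1: "0 \<le> ?N1" using B0 by simp
  show "0 \<le> dm * (?N1 * (?N2 * ?N3))" using N1 N2 dm_ge_1 by (intro mult_nonneg_nonneg) auto
  fix Z assume Z: "Z \<subseteq> {p\<in>P. \<bar>h p\<bar> \<le> \<epsilon> \<and> c / 2 < norm (g p) \<and> norm (g p) \<le> c}"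
    and close: "\<And>x y. x \<in> Z \<Longrightarrow> y \<in> Z \<Longrightarrow> norm (x - y) \<le> r1"
  have finZ: "finite Z" by (rule finite_subset[OF _ P(1)]) (use Z in auto)
  have ZQ: "Z \<subseteq> Q" using Z P by auto
  have diam: "norm (x - y) \<le> B * c" if "x \<in> Z" "y \<in> Z" for x y
    using that Z P close c by (intro near_critical_diam[of _ _ \<epsilon>]) auto
  have diamj: "\<bar>x $ j - y $ j\<bar> \<le> B * c" if "x \<in> Z" "y \<in> Z" for x y j
    using diam[OF that] component_le_norm_cart[of "x - y" j] by simp
  have "\<exists>i. c / (2 * dm) \<le> \<bar>g p $ i\<bar>" if "p \<in> Z" for p
  proof (rule ccontr)
    assume "\<nexists>i. c / (2 * dm) \<le> \<bar>g p $ i\<bar>"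
    then have "norm (g p) \<le> dm * (c / (2 * dm))"
      by (intro norm_le_dm) (auto simp: not_le intro: less_imp_le)
    also have "\<dots> = c / 2" using dm_ge_1 by simp
    finally show False using that Z by auto
  qed
  then obtain \<iota> where \<iota>: "\<And>p. p \<in> Z \<Longrightarrow> c / (2 * dm) \<le> \<bar>g p $ \<iota> p\<bar>" by metis
  have "real (card Z) \<le> real (card (\<iota> ` Z)) * (?N1 * (?N2 * ?N3))"
  proof (rule card_le_image_times_fibre[OF finZ])
    fix p0 assume "p0 \<in> Z"
    define i where "i = \<iota> p0"
    define Z1 where "Z1 = {q \<in> Z. \<iota> q = \<iota> p0}"
    \<comment> \<open>Cells of this side have diameter at most \<open>c / (4 * dm)\<close>, the
      closeness that \<open>transversal_diam\<close> asks for.\<close>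
    define \<eta> where "\<eta> = c / (4 * dm\<^sup>2)"
    have \<eta>: "0 < \<eta>" using c dm_ge_1 by (simp add: \<eta>_def)
    have finZ1: "finite Z1" using finZ by (simp add: Z1_def)
    have "real (card Z1) \<le> real (card (grid_cell UNIV \<eta> ` Z1)) * (?N2 * ?N3)"
    proof (rule card_le_image_times_fibre[OF finZ1])
      show "0 \<le> ?N2 * ?N3" using N2 by simp
      fix p1 assume "p1 \<in> Z1"
      define Z2 where "Z2 = {q \<in> Z1. grid_cell UNIV \<eta> q = grid_cell UNIV \<eta> p1}"
      have finZ2: "finite Z2" using finZ1 by (simp add: Z2_def)
      have Z2Z: "Z2 \<subseteq> Z" by (auto simp: Z2_def Z1_def)
      have close2: "norm (x - y) \<le> c / (4 * dm)" if "x \<in> Z2" "y \<in> Z2" for x y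
      proof -
        have "grid_cell UNIV \<eta> x = grid_cell UNIV \<eta> y" using that by (simp add: Z2_def)
        then have "norm (x - y) \<le> dm * \<eta>" using \<eta> by (intro norm_le_dm) (auto dest: grid_cell_eqD)
        then show ?thesis using dm_ge_1 by (simp add: \<eta>_def power2_eq_square field_simps)
      qed
      have w: "0 < \<epsilon> / c" using \<epsilon>0 c by simp
      have "real (card Z2) \<le> real (card (grid_cell (UNIV - {i}) (\<epsilon> / c) ` Z2)) * ?N3"
      proof (rule card_le_image_times_fibre[OF finZ2])
        fix p assume p: "p \<in> Z2"
        show "real (card {q \<in> Z2. grid_cell (UNIV - {i}) (\<epsilon> / c) q = grid_cell (UNIV - {i}) (\<epsilon> / c) p}) \<le> ?N3"
        proof (rule card_near_le)
          show "p \<in> P" using p Z2Z Z by auto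
          have "\<epsilon> \<le> \<epsilon> / c" using c \<epsilon>0 by (simp add: field_simps)
          also have "\<dots> \<le> C1 * (\<epsilon> / c)" using C1_ge_1 w mult_right_mono[of 1 C1 "\<epsilon> / c"] by simp
          finally show "\<delta> \<le> C1 * (\<epsilon> / c)" using \<delta> by linarith
          show "{q \<in> Z2. grid_cell (UNIV - {i}) (\<epsilon> / c) q = grid_cell (UNIV - {i}) (\<epsilon> / c) p} \<subseteq> P"
            using Z2Z Z by auto
          fix q assume q: "q \<in> {q \<in> Z2. grid_cell (UNIV - {i}) (\<epsilon> / c) q = grid_cell (UNIV - {i}) (\<epsilon> / c) p}"
          show "norm (p - q) \<le> C1 * (\<epsilon> / c)" unfolding C1_def
          proof (rule transversal_diam)
            show "c / (2 * dm) \<le> \<bar>g p $ i\<bar>" using \<iota>[of p] p Z2Z by (auto simp: Z2_def Z1_def i_def)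
            show "norm (p - q) \<le> c / (4 * dm)" using close2 p q by auto
            show "\<bar>p $ j - q $ j\<bar> \<le> \<epsilon> / c" if "j \<noteq> i" for j
              using q that w by (intro grid_cell_eqD[of "UNIV - {i}"]) auto
          qed (use p q Z2Z ZQ Z c in auto)
        qed
      qed simp
      also have "real (card (grid_cell (UNIV - {i}) (\<epsilon> / c) ` Z2)) \<le> (B * c / (\<epsilon> / c) + 2) ^ card (UNIV - {i})"
        using diamj Z2Z B0 c by (intro card_grid_cells_le[OF finZ2 w]) auto
      also have "\<dots> \<le> ?N2"
      proof -
        have "B * c / (\<epsilon> / c) + 2 \<le> (B + 2) * (c\<^sup>2 / \<epsilon>)"
          using c \<epsilon>0 by (simp add: field_simps power2_eq_square)
        then show ?thesis using B0 c \<epsilon>0 by (auto simp: card_Diff_singleton intro!: power_mono)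
      qed
      finally show "real (card {q \<in> Z1. grid_cell UNIV \<eta> q = grid_cell UNIV \<eta> p1}) \<le> ?N2 * ?N3"
        by (simp add: Z2_def mult_right_mono)
    qed
    also have "real (card (grid_cell UNIV \<eta> ` Z1)) \<le> (B * c / \<eta> + 2) ^ CARD('n)"
      using diamj B0 c by (intro card_grid_cells_le[OF finZ1 \<eta>]) (auto simp: Z1_def)
    also have "B * c / \<eta> = 4 * dm\<^sup>2 * B" using c by (simp add: \<eta>_def)
    finally show "real (card {q \<in> Z. \<iota> q = \<iota> p0}) \<le> ?N1 * (?N2 * ?N3)"
      using N2 by (simp add: Z1_def mult_right_mono)
  qed (use N1 N2 in auto)
  also have "\<dots> \<le> dm * (?N1 * (?N2 * ?N3))"
  proof (rule mult_right_mono)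
    show "real (card (\<iota> ` Z)) \<le> dm" using card_mono[of UNIV "\<iota> ` Z"] by (simp add: dm)
  qed (use N1 N2 in simp)
  finally show "real (card Z) \<le> dm * (?N1 * (?N2 * ?N3))" .
qed auto

text \<open>The value depends only on the constants of the locale, the dimension and
  \<open>m\<close>, so it serves for all pairs of the family and all scales at once.\<close>

definition "KC = 2 * (dm / r1 + 2) ^ CARD('n) * (B powr m +
   dm * (4 * dm\<^sup>2 * B + 2) ^ CARD('n) * (B + 2) ^ (CARD('n) - 1) * C1 powr m)"

lemma card_near_zero_set_le:
  assumes n: "2 \<le> CARD('n)" and s: "0 < s" "s \<le> 1" and ms: "m = dm - 1 + s" and k: "\<delta> = (1/2) ^ k"
  shows "real (card {p\<in>P. \<bar>h p\<bar> \<le> \<epsilon>}) \<le> KC * (real k + 1) * (\<epsilon> powr s * \<delta> powr - m)"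
proof -
  let ?A = "(dm / r1 + 2) ^ CARD('n)" and ?E = "\<epsilon> powr s * \<delta> powr - m"
  let ?N = "dm * (4 * dm\<^sup>2 * B + 2) ^ CARD('n) * (B + 2) ^ (CARD('n) - 1) * C1 powr m"
  have \<epsilon>0: "0 < \<epsilon>" using \<delta> by linarith
  have A0: "0 \<le> ?A" using pos dm_ge_1 by simp
  have B0: "0 < B" using B_ge_1 by linarith
  have C10: "0 < C1" using C1_ge_1 by linarith
  have N0: "0 \<le> ?N" using dm_ge_1 B0 by (intro mult_nonneg_nonneg) auto
  let ?core = "{p\<in>P. \<bar>h p\<bar> \<le> \<epsilon> \<and> norm (g p) \<le> sqrt \<epsilon>}"
  let ?sc = "\<lambda>l::nat. {p\<in>P. \<bar>h p\<bar> \<le> \<epsilon> \<and> (1/2)^l / 2 < norm (g p) \<and> norm (g p) \<le> (1/2)^l}"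
  define I where "I = {l. l < k \<and> \<epsilon> \<le> ((1/2)^l)\<^sup>2}"
  have finI: "finite I" by (simp add: I_def)
  have core: "real (card ?core) \<le> 2 * ?A * B powr m * ?E"
  proof -
    have "(B * sqrt \<epsilon> / \<delta>) powr m = B powr m * (\<epsilon> powr (m / 2) * \<delta> powr - m)"
    proof -
      have "sqrt \<epsilon> powr m = (\<epsilon> powr (1/2)) powr m" using \<epsilon>0 by (simp add: powr_half_sqrt)
      then have "sqrt \<epsilon> powr m = \<epsilon> powr (m / 2)" by (simp only: powr_powr) simp
      then show ?thesis using B0 \<epsilon>0 \<delta> by (simp add: powr_divide powr_mult powr_minus_divide)
    qed
    \<comment> \<open>Here \<open>m / 2 \<ge> s\<close>, because
      \<open>dm - 1 \<ge> 1 \<ge> s\<close>.\<close>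
    also have "\<dots> \<le> B powr m * ?E"
      using \<epsilon> \<epsilon>0 n s ms by (intro mult_left_mono mult_right_mono powr_mono') (auto simp: dm)
    finally have "(B * sqrt \<epsilon> / \<delta>) powr m \<le> B powr m * ?E" .
    from mult_left_mono[OF this, of "?A * 2"] A0 card_critical_le show ?thesis by (simp add: mult_ac)
  qed
  have sc: "real (card (?sc l)) \<le> 2 * ?A * ?N * ?E" if "l \<in> I" for l
  proof -
    define c where "c = (1/2::real)^l"
    have c: "0 < c" "c \<le> 1" "\<epsilon> \<le> c\<^sup>2" using that by (auto simp: c_def I_def power_le_one)
    have "(c\<^sup>2 / \<epsilon>) ^ (CARD('n) - 1) = (c\<^sup>2 / \<epsilon>) powr (dm - 1)"
      using c \<epsilon>0 n by (subst powr_realpow[symmetric]) (auto simp: dm of_nat_diff)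
    also have "\<dots> = c powr (2 * (dm - 1)) * \<epsilon> powr - (dm - 1)"
    proof -
      have "(c\<^sup>2 / \<epsilon>) powr a = c powr (2 * a) * \<epsilon> powr - a" for a
        using c \<epsilon>0 by (simp add: powr_divide powr_powr powr_minus_divide flip: powr_numeral)
      then show ?thesis .
    qed
    finally have e1: "(c\<^sup>2 / \<epsilon>) ^ (CARD('n) - 1) = c powr (2 * (dm - 1)) * \<epsilon> powr - (dm - 1)" .
    have e2: "(C1 * (\<epsilon> / c) / \<delta>) powr m = C1 powr m * (\<epsilon> powr m * c powr - m * \<delta> powr - m)"
      using c \<epsilon>0 \<delta> C10 by (simp add: powr_divide powr_mult powr_minus_divide)
    have "c powr (2 * (dm - 1)) * \<epsilon> powr - (dm - 1) * (\<epsilon> powr m * c powr - m)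
        = c powr (2 * (dm - 1) + - m) * \<epsilon> powr (- (dm - 1) + m)"
      by (simp only: powr_add mult_ac)
    also have "\<dots> \<le> 1 * \<epsilon> powr s"
    proof (intro mult_mono)
      have "2 * (dm - 1) + - m \<ge> 0" using n s ms by (auto simp: dm)
      then show "c powr (2 * (dm - 1) + - m) \<le> 1" using c by (intro powr_le1) auto
    qed (auto simp: ms)
    finally have e3: "c powr (2 * (dm - 1)) * \<epsilon> powr - (dm - 1) * (\<epsilon> powr m * c powr - m) \<le> \<epsilon> powr s" by simp
    have "real (card (?sc l)) \<le> ?A * (dm * ((4 * dm\<^sup>2 * B + 2) ^ CARD('n) *
         (((B + 2) * (c\<^sup>2 / \<epsilon>)) ^ (CARD('n) - 1) * (2 * (C1 * (\<epsilon> / c) / \<delta>) powr m))))"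
      using card_scale_le[OF c] unfolding c_def by simp
    also have "\<dots> = (2 * ?A * ?N) *
        (c powr (2 * (dm - 1)) * \<epsilon> powr - (dm - 1) * (\<epsilon> powr m * c powr - m)) * \<delta> powr - m"
      unfolding power_mult_distrib e1 e2 by (simp only: mult_ac)
    also have "\<dots> \<le> (2 * ?A * ?N) * \<epsilon> powr s * \<delta> powr - m"
      using A0 N0 e3 by (intro mult_right_mono mult_left_mono) auto
    finally show ?thesis by (simp only: mult_ac)
  qed
  have "{p\<in>P. \<bar>h p\<bar> \<le> \<epsilon>} \<subseteq> ?core \<union> (\<Union>l\<in>I. ?sc l)"
  proof
    fix p assume p: "p \<in> {p\<in>P. \<bar>h p\<bar> \<le> \<epsilon>}"
    show "p \<in> ?core \<union> (\<Union>l\<in>I. ?sc l)"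
    proof (cases "norm (g p) \<le> sqrt \<epsilon>")
      case False
      have g1: "norm (g p) \<le> 1" using g_le_1 p P by auto
      have g0: "sqrt \<epsilon> < norm (g p)" "0 < sqrt \<epsilon>" using False \<epsilon>0 by auto
      obtain l where l: "(1/2) ^ Suc l < norm (g p)" "norm (g p) \<le> (1/2) ^ l"
        using dyadic_scale[OF less_trans[OF g0(2,1)] g1] by blast
      have sl: "sqrt \<epsilon> < (1/2) ^ l" using g0 l by linarith
      then have "(sqrt \<epsilon>)\<^sup>2 \<le> ((1/2) ^ l)\<^sup>2" using g0 by (intro power_mono) auto
      \<comment> \<open>Otherwise \<open>sqrt \<epsilon> < (1/2) ^ l \<le> \<delta> \<le> \<epsilon>
        \<le> sqrt \<epsilon>\<close>.\<close>
      moreover have "l < k"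
      proof (rule ccontr)
        assume "\<not> l < k"
        then have "(1/2) ^ l \<le> (1/2::real) ^ k" by (intro power_decreasing) auto
        moreover have "\<epsilon> \<le> sqrt \<epsilon>" using \<epsilon>0 \<epsilon> by (intro real_le_rsqrt) (simp add: power2_eq_square mult_left_le)
        ultimately show False using sl k \<delta> by linarith
      qed
      ultimately have "l \<in> I" using \<epsilon>0 by (simp add: I_def)
      moreover have "p \<in> ?sc l" using p l by simp
      ultimately show ?thesis by blast
    qed (use p in auto)
  qed
  moreover have "finite (?core \<union> (\<Union>l\<in>I. ?sc l))" using P finI by auto
  ultimately have "card {p\<in>P. \<bar>h p\<bar> \<le> \<epsilon>} \<le> card (?core \<union> (\<Union>l\<in>I. ?sc l))" by (intro card_mono)
  also have "\<dots> \<le> card ?core + (\<Sum>l\<in>I. card (?sc l))"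
    by (rule order_trans[OF card_Un_le add_left_mono[OF card_UN_le[OF finI]]])
  finally have "real (card {p\<in>P. \<bar>h p\<bar> \<le> \<epsilon>}) \<le> real (card ?core) + (\<Sum>l\<in>I. real (card (?sc l)))"
    by (simp flip: of_nat_sum of_nat_add)
  also have "\<dots> \<le> 2 * ?A * B powr m * ?E + (\<Sum>l\<in>I. 2 * ?A * ?N * ?E)"
    by (intro add_mono core sum_mono sc)
  also have "\<dots> = 2 * ?A * B powr m * ?E + real (card I) * (2 * ?A * ?N * ?E)" by simp
  also have "\<dots> \<le> (real k + 1) * (2 * ?A * B powr m * ?E) + (real k + 1) * (2 * ?A * ?N * ?E)"
  proof (intro add_mono mult_right_mono)
    show "2 * ?A * B powr m * ?E \<le> (real k + 1) * (2 * ?A * B powr m * ?E)"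
      using A0 by (simp add: distrib_right)
    have "card I \<le> card {..<k}" by (intro card_mono) (auto simp: I_def)
    then show "real (card I) \<le> real k + 1" by simp
  qed (use A0 N0 in auto)
  also have "\<dots> = KC * (real k + 1) * ?E" unfolding KC_def by (simp add: algebra_simps)
  finally show ?thesis .
qed

end
end

section \<open>The C2 norm on the cube\<close>

lemma mem_unit_cube: "x \<in> unit_cube \<longleftrightarrow> (\<forall>i. 0 \<le> x $ i \<and> x $ i \<le> 1)" for x :: "real^'n"
proof -
  have "(One :: real^'n) \<bullet> axis i 1 = 1" for i
    by (simp add: inner_sum_left inner_Basis axis_in_Basis_iff)
  then have "(One :: real^'n) $ i = 1" for i by (simp only: inner_axis) simp
  then show ?thesis unfolding unit_cube_def mem_box_cart by (simp only: zero_index)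
qed

lemma compact_unit_cube: "compact unit_cube"
  and convex_unit_cube: "convex unit_cube"
  and zero_in_unit_cube: "0 \<in> unit_cube"
  by (auto simp: unit_cube_def) (auto simp: mem_unit_cube[unfolded unit_cube_def])

lemma linear_eq_inner_axis:
  fixes L :: "real^'n \<Rightarrow> real"
  assumes "linear L" shows "L v = (\<chi> i. L (axis i 1)) \<bullet> v"
proof -
  have "L v = L (\<Sum>i\<in>UNIV. v $ i *\<^sub>R axis i 1)"
    using basis_expansion[of v] by (simp add: scalar_mult_eq_scaleR)
  also have "\<dots> = (\<Sum>i\<in>UNIV. v $ i * L (axis i 1))"
    using assms by (simp add: linear_sum linear_scale)
  finally show ?thesis by (simp add: inner_vec_def mult.commute)
qed

lemma has_derivative_grad:
  assumes "f differentiable (at x)"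
  shows "(f has_derivative (\<lambda>v. grad f x \<bullet> v)) (at x)"
proof -
  have "(f has_derivative frechet_derivative f (at x)) (at x)"
    using assms by (simp add: frechet_derivative_works)
  moreover have "frechet_derivative f (at x) = (\<lambda>v. grad f x \<bullet> v)"
    by (rule ext, unfold grad_def) (rule linear_eq_inner_axis[OF linear_frechet_derivative[OF assms]])
  ultimately show ?thesis by simp
qed

lemma grad_eqI:
  assumes "(f has_derivative (\<lambda>v. a \<bullet> v)) (at x)" shows "grad f x = a"
  using frechet_derivative_at[OF assms, symmetric] by (simp add: grad_def vec_eq_iff inner_axis)

lemma hess_eq_grad: "hess f x $ i $ j = grad (\<lambda>y. grad f y $ j) x $ i"
  by (simp add: hess_def grad_def)

lemma C2_on_differentiable:
  assumes "C2_on S f" "x \<in> S"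
  shows "f differentiable (at x)" "(\<lambda>y. grad f y $ j) differentiable (at x)"
proof -
  have "open S" using assms by (simp add: C2_on_def)
  then have w: "at x within S = at x" by (rule at_within_open[OF assms(2)])
  have "f differentiable (at x within S)" "(\<lambda>y. grad f y $ j) differentiable (at x within S)"
    using assms unfolding C2_on_def differentiable_on_def by blast+
  then show "f differentiable (at x)" "(\<lambda>y. grad f y $ j) differentiable (at x)" unfolding w .
qed

lemma C2_on_diff:
  assumes f: "C2_on S f" and g: "C2_on S g"
  shows "C2_on S (\<lambda>x. f x - g x)"
    and "\<And>x. x \<in> S \<Longrightarrow> grad (\<lambda>x. f x - g x) x = grad f x - grad g x"
    and "\<And>x. x \<in> S \<Longrightarrow> hess (\<lambda>x. f x - g x) x = hess f x - hess g x"
proof -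
  have S: "open S" using f by (simp add: C2_on_def)
  have df: "f differentiable (at x)" "g differentiable (at x)"
    "(\<lambda>y. grad f y $ j) differentiable (at x)" "(\<lambda>y. grad g y $ j) differentiable (at x)" if "x \<in> S" for x j
    using C2_on_differentiable[OF f that] C2_on_differentiable[OF g that] by blast+
  show gr: "grad (\<lambda>x. f x - g x) x = grad f x - grad g x" if "x \<in> S" for x
    using has_derivative_diff[OF has_derivative_grad has_derivative_grad, OF df(1,2)[OF that]]
    by (intro grad_eqI) (simp add: inner_diff_left)
  have d2: "((\<lambda>y. grad (\<lambda>x. f x - g x) y $ j) has_derivative
      (\<lambda>v. (grad (\<lambda>y. grad f y $ j) x - grad (\<lambda>y. grad g y $ j) x) \<bullet> v)) (at x)" if "x \<in> S" for x j
  \<comment> \<open>The formula \<open>gr\<close> for the gradient of the difference is known on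
    \<open>S\<close> only; openness of \<open>S\<close> lets it be differentiated.\<close>
  proof (rule has_derivative_transform_within_open[OF _ S that])
    show "((\<lambda>y. grad f y $ j - grad g y $ j) has_derivative
      (\<lambda>v. (grad (\<lambda>y. grad f y $ j) x - grad (\<lambda>y. grad g y $ j) x) \<bullet> v)) (at x)"
      using has_derivative_diff[OF has_derivative_grad has_derivative_grad, OF df(3,4)[OF that]]
      by (simp add: inner_diff_left)
  qed (simp add: gr)
  show he: "hess (\<lambda>x. f x - g x) x = hess f x - hess g x" if "x \<in> S" for x
    using grad_eqI[OF d2[OF that]] by (simp add: vec_eq_iff hess_eq_grad)
  have "(\<lambda>y. grad (\<lambda>x. f x - g x) y $ j) differentiable_on S" for j
    using d2 unfolding differentiable_on_def differentiable_def by (blast intro: has_derivative_at_withinI)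
  moreover have "continuous_on S (hess (\<lambda>x. f x - g x))"
    using f g unfolding C2_on_def by (subst continuous_on_cong[OF refl he]) (auto intro: continuous_on_diff)
  ultimately show "C2_on S (\<lambda>x. f x - g x)"
    using f g unfolding C2_on_def by auto
qed

lemma C2_on_subset: "C2_on S f \<Longrightarrow> open T \<Longrightarrow> T \<subseteq> S \<Longrightarrow> C2_on T f"
  unfolding C2_on_def by (meson continuous_on_subset differentiable_on_subset)

lemma C2_cube_diff:
  assumes "f \<in> C2_cube" "g \<in> C2_cube"
  shows "(\<lambda>x. f x - g x) \<in> C2_cube"
    and "\<And>x. x \<in> unit_cube \<Longrightarrow> grad (\<lambda>x. f x - g x) x = grad f x - grad g x"
    and "\<And>x. x \<in> unit_cube \<Longrightarrow> hess (\<lambda>x. f x - g x) x = hess f x - hess g x"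
proof -
  obtain S T where S: "unit_cube \<subseteq> S" "C2_on S f" and T: "unit_cube \<subseteq> T" "C2_on T g"
    using assms unfolding C2_cube_def by auto
  have "open (S \<inter> T)" using S T by (auto simp: C2_on_def)
  then have "C2_on (S \<inter> T) f" "C2_on (S \<inter> T) g" using S T C2_on_subset by blast+
  note * = C2_on_diff[OF this]
  show "(\<lambda>x. f x - g x) \<in> C2_cube" using *(1) S T unfolding C2_cube_def by blast
  show "\<And>x. x \<in> unit_cube \<Longrightarrow> grad (\<lambda>x. f x - g x) x = grad f x - grad g x"
    "\<And>x. x \<in> unit_cube \<Longrightarrow> hess (\<lambda>x. f x - g x) x = hess f x - hess g x"
    using *(2,3) S T by auto
qed

text \<open>In \<open>hess\<close> the row index is the direction of differentiation, so the
  derivative of \<open>grad f y \<bullet> \<xi>\<close> along \<open>v\<close> has \<open>v\<close>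
  on the left of the Hessian.\<close>

lemma C2_cube_derivatives:
  assumes "f \<in> C2_cube" "x \<in> unit_cube"
  shows "(f has_derivative (\<lambda>v. grad f x \<bullet> v)) (at x)"
    and "((\<lambda>y. grad f y \<bullet> \<xi>) has_derivative (\<lambda>v. v \<bullet> (hess f x *v \<xi>))) (at x)"
proof -
  obtain S where S: "unit_cube \<subseteq> S" "C2_on S f" using assms unfolding C2_cube_def by auto
  then have "x \<in> S" using assms by auto
  note d = C2_on_differentiable[OF S(2) this]
  show "(f has_derivative (\<lambda>v. grad f x \<bullet> v)) (at x)" by (rule has_derivative_grad[OF d(1)])
  have "((\<lambda>y. \<Sum>j\<in>UNIV. grad f y $ j * \<xi> $ j) has_derivative
     (\<lambda>v. \<Sum>j\<in>UNIV. grad (\<lambda>y. grad f y $ j) x \<bullet> v * \<xi> $ j)) (at x)"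
    by (intro has_derivative_sum has_derivative_mult_left has_derivative_grad d)
  moreover have "(\<Sum>j\<in>UNIV. grad (\<lambda>y. grad f y $ j) x \<bullet> v * \<xi> $ j) = v \<bullet> (hess f x *v \<xi>)" for v
  proof -
    have "(\<Sum>j\<in>UNIV. grad (\<lambda>y. grad f y $ j) x \<bullet> v * \<xi> $ j)
        = (\<Sum>j\<in>UNIV. \<Sum>i\<in>UNIV. v $ i * (hess f x $ i $ j * \<xi> $ j))"
      by (simp add: inner_vec_def hess_eq_grad sum_distrib_left sum_distrib_right mult_ac)
    also have "\<dots> = (\<Sum>i\<in>UNIV. \<Sum>j\<in>UNIV. v $ i * (hess f x $ i $ j * \<xi> $ j))" by (rule sum.swap)
    also have "\<dots> = v \<bullet> (hess f x *v \<xi>)"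
      by (simp add: inner_vec_def matrix_vector_mult_def sum_distrib_left)
    finally show ?thesis .
  qed
  ultimately show "((\<lambda>y. grad f y \<bullet> \<xi>) has_derivative (\<lambda>v. v \<bullet> (hess f x *v \<xi>))) (at x)"
    by (simp add: inner_vec_def)
qed

text \<open>The suprema in \<open>c2norm\<close> are taken in the reals and are informative only for
  bounded sets. Compactness of the cube provides bounds; for the operator norm the sum of the
  absolute entries is used.\<close>

lemma C2_cube_bounded:
  assumes "f \<in> C2_cube"
  shows "bdd_above ((\<lambda>x. \<bar>f x\<bar>) ` unit_cube)" "bdd_above ((\<lambda>x. norm (grad f x)) ` unit_cube)"
    "bdd_above ((\<lambda>x. onorm (\<lambda>v. hess f x *v v)) ` unit_cube)"
proof -
  have bdd: "bdd_above (\<phi> ` unit_cube)" if "continuous_on unit_cube \<phi>" for \<phi> :: "real^'n \<Rightarrow> real"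
    using compact_continuous_image[OF that compact_unit_cube] by (intro bounded_imp_bdd_above compact_imp_bounded)
  obtain S where S: "unit_cube \<subseteq> S" "C2_on S f" using assms unfolding C2_cube_def by auto
  have "continuous_on unit_cube f"
    by (rule continuous_at_imp_continuous_on) (blast intro: has_derivative_continuous C2_cube_derivatives(1)[OF assms])
  then show "bdd_above ((\<lambda>x. \<bar>f x\<bar>) ` unit_cube)" by (intro bdd continuous_on_rabs)
  have "continuous_on unit_cube (\<lambda>y. grad f y \<bullet> \<xi>)" for \<xi>
    by (rule continuous_at_imp_continuous_on) (blast intro: has_derivative_continuous C2_cube_derivatives(2)[OF assms])
  then have "continuous_on unit_cube (\<lambda>y. grad f y \<bullet> axis j 1)" for j by blast
  then have "continuous_on unit_cube (\<lambda>y. \<chi> j. grad f y $ j)"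
    by (intro continuous_on_vec_lambda) (simp add: inner_axis)
  then show "bdd_above ((\<lambda>x. norm (grad f x)) ` unit_cube)" by (intro bdd continuous_on_norm) simp
  have "continuous_on unit_cube (hess f)" using S unfolding C2_on_def by (auto intro: continuous_on_subset)
  then have "continuous_on unit_cube (\<lambda>x. \<Sum>i\<in>UNIV. \<Sum>j\<in>UNIV. \<bar>hess f x $ i $ j\<bar>)"
    by (intro continuous_on_sum continuous_on_rabs continuous_on_component)
  from bdd[OF this] obtain M where "\<And>x. x \<in> unit_cube \<Longrightarrow> (\<Sum>i\<in>UNIV. \<Sum>j\<in>UNIV. \<bar>hess f x $ i $ j\<bar>) \<le> M"
    by (auto simp: bdd_above_def)
  then show "bdd_above ((\<lambda>x. onorm (\<lambda>v. hess f x *v v)) ` unit_cube)"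
    using order_trans[OF onorm_le_matrix_component_sum] by (intro bdd_aboveI2[of _ _ M]) blast
qed

lemma c2normE:
  assumes "f \<in> C2_cube"
  obtains a b c where "c2norm f = a + b + c" "0 \<le> a" "0 \<le> b" "0 \<le> c"
    "\<And>x. x \<in> unit_cube \<Longrightarrow> \<bar>f x\<bar> \<le> a" "\<And>x. x \<in> unit_cube \<Longrightarrow> norm (grad f x) \<le> b"
    "\<And>x. x \<in> unit_cube \<Longrightarrow> onorm (\<lambda>v. hess f x *v v) \<le> c"
proof -
  let ?a = "SUP x\<in>unit_cube. \<bar>f x\<bar>" and ?b = "SUP x\<in>unit_cube. norm (grad f x)"
    and ?c = "SUP x\<in>unit_cube. onorm (\<lambda>v. hess f x *v v)"
  note le = cSUP_upper[OF _ C2_cube_bounded(1)[OF assms]] cSUP_upper[OF _ C2_cube_bounded(2)[OF assms]]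
    cSUP_upper[OF _ C2_cube_bounded(3)[OF assms]]
  have "0 \<le> onorm (\<lambda>v. hess f 0 *v v)" by (rule onorm_pos_le[OF matrix_vector_mul_bounded_linear])
  then have "0 \<le> ?a" "0 \<le> ?b" "0 \<le> ?c"
    using le[OF zero_in_unit_cube] by (auto intro: order_trans[OF abs_ge_zero] order_trans[OF norm_ge_zero] order_trans)
  then show ?thesis using le by (intro that[of ?a ?b ?c]) (auto simp: c2norm_def)
qed

lemma c2norm_le:
  assumes "\<And>x. x \<in> unit_cube \<Longrightarrow> \<bar>f x\<bar> \<le> a" "\<And>x. x \<in> unit_cube \<Longrightarrow> norm (grad f x) \<le> b"
    "\<And>x. x \<in> unit_cube \<Longrightarrow> onorm (\<lambda>v. hess f x *v v) \<le> c"
  shows "c2norm f \<le> a + b + c"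
  unfolding c2norm_def using assms zero_in_unit_cube by (intro add_mono cSUP_least) auto

text \<open>\<open>c2dist\<close> is only a pseudometric, since functions are compared on the cube
  but not restricted to it. The Frostman construction asks for exactly the properties proved from
  here on.\<close>

lemma c2dist_nonneg: "f \<in> C2_cube \<Longrightarrow> g \<in> C2_cube \<Longrightarrow> 0 \<le> c2dist f g"
  unfolding c2dist_def by (rule c2normE[OF C2_cube_diff(1), of f g]) auto

lemma c2dist_commute:
  assumes "f \<in> C2_cube" "g \<in> C2_cube" shows "c2dist f g = c2dist g f"
proof -
  have "c2dist f g \<le> c2dist g f" if fg: "f \<in> C2_cube" "g \<in> C2_cube" for f g :: "real^'n \<Rightarrow> real"
  proof -
    obtain a b c where *: "c2norm (\<lambda>x. g x - f x) = a + b + c" "0 \<le> a" "0 \<le> b" "0 \<le> c"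
      "\<And>x. x \<in> unit_cube \<Longrightarrow> \<bar>g x - f x\<bar> \<le> a"
      "\<And>x. x \<in> unit_cube \<Longrightarrow> norm (grad (\<lambda>x. g x - f x) x) \<le> b"
      "\<And>x. x \<in> unit_cube \<Longrightarrow> onorm (\<lambda>v. hess (\<lambda>x. g x - f x) x *v v) \<le> c"
      by (rule c2normE[OF C2_cube_diff(1)[OF fg(2,1)]]) blast
    have "onorm (\<lambda>v. (hess f x - hess g x) *v v) = onorm (\<lambda>v. (hess g x - hess f x) *v v)" for x
      using onorm_neg[of "\<lambda>v. (hess f x - hess g x) *v v"]
      by (simp add: matrix_vector_mult_diff_rdistrib)
    then show ?thesis unfolding c2dist_def *(1)
      using *(5-) C2_cube_diff(2,3)[OF that] C2_cube_diff(2,3)[OF that(2,1)]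
      by (intro c2norm_le) (auto simp: abs_minus_commute norm_minus_commute)
  qed
  then show ?thesis using assms by (meson antisym)
qed

lemma c2dist_self: assumes "f \<in> C2_cube" shows "c2dist f f = 0"
proof -
  have "c2dist f f \<le> 0 + 0 + 0" unfolding c2dist_def
    using C2_cube_diff(2,3)[OF assms assms] by (intro c2norm_le) (auto simp: onorm_zero)
  then show ?thesis using c2dist_nonneg[OF assms assms] by simp
qed

lemma c2dist_triangle:
  fixes f g h :: "real^'n \<Rightarrow> real"
  assumes "f \<in> C2_cube" "g \<in> C2_cube" "h \<in> C2_cube"
  shows "c2dist f h \<le> c2dist f g + c2dist g h"
proof -
  obtain a b c where 1: "c2norm (\<lambda>x. f x - g x) = a + b + c" "0 \<le> a" "0 \<le> b" "0 \<le> c"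
      "\<And>x. x \<in> unit_cube \<Longrightarrow> \<bar>f x - g x\<bar> \<le> a"
      "\<And>x. x \<in> unit_cube \<Longrightarrow> norm (grad (\<lambda>x. f x - g x) x) \<le> b"
      "\<And>x. x \<in> unit_cube \<Longrightarrow> onorm (\<lambda>v. hess (\<lambda>x. f x - g x) x *v v) \<le> c"
      by (rule c2normE[OF C2_cube_diff(1)[OF assms(1,2)]]) blast
  obtain a' b' c' where 2: "c2norm (\<lambda>x. g x - h x) = a' + b' + c'" "0 \<le> a'" "0 \<le> b'" "0 \<le> c'"
      "\<And>x. x \<in> unit_cube \<Longrightarrow> \<bar>g x - h x\<bar> \<le> a'"
      "\<And>x. x \<in> unit_cube \<Longrightarrow> norm (grad (\<lambda>x. g x - h x) x) \<le> b'"
      "\<And>x. x \<in> unit_cube \<Longrightarrow> onorm (\<lambda>v. hess (\<lambda>x. g x - h x) x *v v) \<le> c'"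
      by (rule c2normE[OF C2_cube_diff(1)[OF assms(2,3)]]) blast
  have "c2norm (\<lambda>x. f x - h x) \<le> (a + a') + (b + b') + (c + c')"
  proof (rule c2norm_le)
    fix x :: "real^'n" assume x: "x \<in> unit_cube"
    show "\<bar>f x - h x\<bar> \<le> a + a'" using 1(5)[OF x] 2(5)[OF x] by linarith
    have "grad (\<lambda>x. f x - h x) x = grad (\<lambda>x. f x - g x) x + grad (\<lambda>x. g x - h x) x"
      using C2_cube_diff(2)[OF assms(1,3) x] C2_cube_diff(2)[OF assms(1,2) x] C2_cube_diff(2)[OF assms(2,3) x] by simp
    then show "norm (grad (\<lambda>x. f x - h x) x) \<le> b + b'"
      using 1(6)[OF x] 2(6)[OF x] norm_triangle_ineq by (smt (verit))
    have "hess (\<lambda>x. f x - h x) x = hess (\<lambda>x. f x - g x) x + hess (\<lambda>x. g x - h x) x"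
      using C2_cube_diff(3)[OF assms(1,3) x] C2_cube_diff(3)[OF assms(1,2) x] C2_cube_diff(3)[OF assms(2,3) x] by simp
    then have "onorm (\<lambda>v. hess (\<lambda>x. f x - h x) x *v v) =
        onorm (\<lambda>v. hess (\<lambda>x. f x - g x) x *v v + hess (\<lambda>x. g x - h x) x *v v)"
      by (simp add: matrix_vector_mult_add_rdistrib)
    also have "\<dots> \<le> onorm (\<lambda>v. hess (\<lambda>x. f x - g x) x *v v) + onorm (\<lambda>v. hess (\<lambda>x. g x - h x) x *v v)"
      by (rule onorm_triangle) (rule matrix_vector_mul_bounded_linear)+
    finally show "onorm (\<lambda>v. hess (\<lambda>x. f x - h x) x *v v) \<le> c + c'"
      using 1(7)[OF x] 2(7)[OF x] by linarith
  qed
  then show ?thesis unfolding c2dist_def 1(1) 2(1) by simp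
qed

text \<open>The mean value theorem on a segment, which convexity keeps in the cube. The bound on
  \<open>norm (z - x)\<close> later keeps values and gradients at \<open>z\<close> comparable with
  those at \<open>x\<close>.\<close>

lemma unit_cube_mvt:
  fixes F :: "real^'n \<Rightarrow> real"
  assumes D: "\<And>x. x \<in> unit_cube \<Longrightarrow> (F has_derivative D x) (at x)"
    and x: "x \<in> unit_cube" and y: "y \<in> unit_cube"
  shows "\<exists>z\<in>unit_cube. norm (z - x) \<le> norm (y - x) \<and> F x - F y = D z (x - y)"
proof -
  let ?z = "\<lambda>t::real. y + t *\<^sub>R (x - y)"
  have z: "?z t \<in> unit_cube" if "0 \<le> t" "t \<le> 1" for t
    using convexD_alt[OF convex_unit_cube y x that] by (simp add: algebra_simps)
  have "((\<lambda>t. F (?z t)) has_derivative (\<lambda>s. D (?z t) (s *\<^sub>R (x - y)))) (at t within {0..1})" if "0 \<le> t" "t \<le> 1" for t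
    by (rule has_derivative_compose[of ?z "\<lambda>s. s *\<^sub>R (x - y)", OF _ D[OF z[OF that]]])
      (auto intro!: derivative_eq_intros)
  from mvt_simple[OF _ this] obtain t where t: "0 < t" "t < 1" "F (?z 1) - F (?z 0) = D (?z t) ((1 - 0) *\<^sub>R (x - y))"
    by auto
  have "?z t - x = (1 - t) *\<^sub>R (y - x)" by (simp add: algebra_simps)
  then have "norm (?z t - x) = (1 - t) * norm (y - x)" using t by simp
  also have "\<dots> \<le> 1 * norm (y - x)" using t by (intro mult_right_mono) auto
  finally have "norm (?z t - x) \<le> norm (y - x)" by simp
  moreover have "F x - F y = D (?z t) (x - y)" using t(3) by simp
  moreover have "?z t \<in> unit_cube" using t by (intro z) auto
  ultimately show ?thesis by blast
qed

lemma C2_cube_estimates: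
  assumes f: "f \<in> C2_cube"
  shows "\<And>x. x \<in> unit_cube \<Longrightarrow> norm (grad f x) \<le> c2norm f"
    and "\<And>x y. x \<in> unit_cube \<Longrightarrow> y \<in> unit_cube \<Longrightarrow> \<bar>f x - f y\<bar> \<le> c2norm f * norm (x - y)"
    and "\<And>x y. x \<in> unit_cube \<Longrightarrow> y \<in> unit_cube \<Longrightarrow> norm (grad f x - grad f y) \<le> c2norm f * norm (x - y)"
proof -
  obtain a b c where *: "c2norm f = a + b + c" "0 \<le> a" "0 \<le> b" "0 \<le> c"
    "\<And>x. x \<in> unit_cube \<Longrightarrow> \<bar>f x\<bar> \<le> a" "\<And>x. x \<in> unit_cube \<Longrightarrow> norm (grad f x) \<le> b"
    "\<And>x. x \<in> unit_cube \<Longrightarrow> onorm (\<lambda>v. hess f x *v v) \<le> c" by (rule c2normE[OF f]) blast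
  show g: "norm (grad f x) \<le> c2norm f" if "x \<in> unit_cube" for x
    using *(6)[OF that] *(1-4) by linarith
  show "\<bar>f x - f y\<bar> \<le> c2norm f * norm (x - y)" if xy: "x \<in> unit_cube" "y \<in> unit_cube" for x y
  proof -
    obtain z where z: "z \<in> unit_cube" "f x - f y = grad f z \<bullet> (x - y)"
      using unit_cube_mvt[OF C2_cube_derivatives(1)[OF f] xy] by blast
    have "\<bar>f x - f y\<bar> \<le> norm (grad f z) * norm (x - y)" unfolding z(2) by (rule Cauchy_Schwarz_ineq2)
    also have "\<dots> \<le> c2norm f * norm (x - y)" using g[OF z(1)] by (intro mult_right_mono) auto
    finally show ?thesis .
  qed
  show "norm (grad f x - grad f y) \<le> c2norm f * norm (x - y)" if xy: "x \<in> unit_cube" "y \<in> unit_cube" for x y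
  proof (cases "grad f x = grad f y")
    case True
    then show ?thesis using * by simp
  next
    case False
    \<comment> \<open>The mean value theorem is scalar, so the gradient is tested against its own
      increment \<open>w\<close>, and one factor \<open>norm w\<close> cancels at the end.\<close>
    define w where "w = grad f x - grad f y"
    obtain z where z: "z \<in> unit_cube" "grad f x \<bullet> w - grad f y \<bullet> w = (x - y) \<bullet> (hess f z *v w)"
      using unit_cube_mvt[OF C2_cube_derivatives(2)[OF f] xy] by blast
    have "norm w * norm w = grad f x \<bullet> w - grad f y \<bullet> w"
      by (simp add: w_def inner_diff_left[symmetric] power2_norm_eq_inner[symmetric] power2_eq_square)
    also have "\<dots> \<le> norm (x - y) * norm (hess f z *v w)" unfolding z(2) by (rule norm_cauchy_schwarz)
    also have "\<dots> \<le> norm (x - y) * (onorm (\<lambda>v. hess f z *v v) * norm w)"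
      by (intro mult_left_mono onorm[OF matrix_vector_mul_bounded_linear]) auto
    also have "\<dots> \<le> norm (x - y) * (c2norm f * norm w)"
      using *(7)[OF z(1)] *(1-4) by (intro mult_left_mono mult_right_mono) auto
    finally have "norm w * norm w \<le> (c2norm f * norm (x - y)) * norm w" by (simp add: mult_ac)
    moreover have "0 < norm w" using False by (simp add: w_def)
    ultimately show ?thesis unfolding w_def by (metis mult_le_cancel_right_pos)
  qed
qed

section \<open>Incidences at a fixed scale\<close>

text \<open>The modulus of continuity forces this:
  \<open>0 < \<alpha> 1 \<le> 1 / K\<close>.\<close>

lemma cinematic_K_pos:
  assumes "cinematic F K D \<alpha>" shows "0 < K"
proof -
  have "\<forall>s\<in>{0<..1}. 0 < \<alpha> s \<and> \<alpha> s \<le> s / K" using assms unfolding cinematic_def by blast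
  then have "0 < 1 / K" by (metis greaterThanAtMost_iff less_eq_real_def order_less_le_trans zero_less_one)
  then show ?thesis by simp
qed

lemma cinematic_c2dist_le:
  assumes cin: "cinematic F K D \<alpha>" and fg: "f \<in> F" "g \<in> F"
  shows "c2dist f g \<le> K"
proof -
  have "F \<subseteq> C2_cube" using cin unfolding cinematic_def by (elim conjE)
  moreover have "\<exists>h\<in>C2_cube. \<forall>f\<in>F. c2dist h f \<le> K / 2" using cin unfolding cinematic_def by (elim conjE)
  ultimately obtain h where h: "h \<in> C2_cube" "c2dist h f \<le> K / 2" "c2dist h g \<le> K / 2" and fg2: "f \<in> C2_cube" "g \<in> C2_cube"
    using fg by blast
  show ?thesis using c2dist_triangle[OF fg2(1) h(1) fg2(2)] c2dist_commute[OF fg2(1) h(1)] h(2,3) by linarith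
qed

lemma dist_unit_cube_le:
  fixes x y :: "real^'n"
  assumes "x \<in> unit_cube" "y \<in> unit_cube" shows "dist x y \<le> real CARD('n)"
proof -
  have "\<bar>(x - y) $ j\<bar> \<le> 1" for j
  proof -
    have "0 \<le> x $ j \<and> x $ j \<le> 1" "0 \<le> y $ j \<and> y $ j \<le> 1" using assms by (auto simp: mem_unit_cube)
    then show ?thesis by auto
  qed
  from norm_le_card_times[OF this] show ?thesis by (simp add: dist_norm)
qed

text \<open>The cinematic condition gives \<open>\<rho> / K\<close> as a lower bound for value,
  gradient and second derivative together. Where value and gradient are small, the second derivative
  in the direction from \<open>y\<close> to \<open>x\<close> must be at least
  \<open>\<rho> / (2 * K)\<close>, and by the mean value theorem the gradient changes at that
  rate.\<close>

lemma cinematic_nondegenerate: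
  fixes F :: "(real^'n \<Rightarrow> real) set"
  assumes cin: "cinematic F K D \<alpha>" and fg: "f \<in> F" "g \<in> F" and \<rho>0: "0 < c2dist f g"
  shows "nondegenerate unit_cube (\<lambda>x. (f x - g x) / c2dist f g) (\<lambda>x. grad (\<lambda>x. f x - g x) x /\<^sub>R c2dist f g)
    (1 / (2 * K)) (min 1 (1 / (8 * K))) (min 1 (1 / (8 * K))) (real CARD('n))"
proof -
  define \<rho> where "\<rho> = c2dist f g"
  define H where "H = (\<lambda>x. f x - g x)"
  define r where "r = min 1 (1 / (8 * K))"
  have K: "0 < K" by (rule cinematic_K_pos[OF cin])
  have F2: "F \<subseteq> C2_cube" using cin unfolding cinematic_def by blast
  then have fg2: "f \<in> C2_cube" "g \<in> C2_cube" using fg by auto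
  note diff = C2_cube_diff[OF fg2, folded H_def]
  have \<rho>: "0 < \<rho>" "c2norm H = \<rho>" using \<rho>0 by (auto simp: \<rho>_def H_def c2dist_def)
  note est = C2_cube_estimates[OF diff(1), unfolded \<rho>(2)]
  have lower: "\<rho> / K \<le> \<bar>H x\<bar> + norm (grad H x) + \<bar>\<xi> \<bullet> (hess H x *v \<xi>)\<bar>" if "x \<in> unit_cube" "norm \<xi> = 1" for x \<xi>
  proof -
    let ?i = "\<lambda>x. \<bar>f x - g x\<bar> + norm (grad f x - grad g x) + \<bar>dxi \<xi> f x - dxi \<xi> g x\<bar>"
    have "\<rho> / K \<le> (INF x\<in>unit_cube. ?i x)"
      using cin fg that(2) unfolding cinematic_def \<rho>_def by blast
    also have "\<dots> \<le> ?i x" by (rule cINF_lower[OF _ that(1)]) (rule bdd_belowI2[of _ 0], simp)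
    finally show ?thesis using diff(2,3)[OF that(1)]
      by (simp add: H_def dxi_def matrix_vector_mult_diff_rdistrib inner_diff_right)
  qed
  have "nondegenerate unit_cube (\<lambda>x. H x / \<rho>) (\<lambda>x. grad H x /\<^sub>R \<rho>) (1 / (2 * K)) r r (real CARD('n))"
  proof
    fix x y :: "real^'n" assume x: "x \<in> unit_cube" and y: "y \<in> unit_cube"
    show "norm (grad H x /\<^sub>R \<rho>) \<le> 1" using est(1)[OF x] \<rho> by (simp add: field_simps)
    have "grad H x /\<^sub>R \<rho> - grad H y /\<^sub>R \<rho> = (grad H x - grad H y) /\<^sub>R \<rho>" by (simp add: algebra_simps)
    then have nd: "norm (grad H x /\<^sub>R \<rho> - grad H y /\<^sub>R \<rho>) = norm (grad H x - grad H y) / \<rho>"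
      using \<rho> by (simp add: divide_inverse mult.commute)
    show "norm (grad H x /\<^sub>R \<rho> - grad H y /\<^sub>R \<rho>) \<le> norm (x - y)"
      unfolding nd using est(3)[OF x y] \<rho> by (simp add: field_simps)
    show "\<bar>x $ j - y $ j\<bar> \<le> 1" for j using x y by (auto simp: mem_unit_cube abs_le_iff dest!: spec[of _ j])
    obtain z where "z \<in> unit_cube" "norm (z - x) \<le> norm (y - x)" "H x - H y = grad H z \<bullet> (x - y)"
      using unit_cube_mvt[OF C2_cube_derivatives(1)[OF diff(1)] x y] by blast
    moreover then have "H x / \<rho> - H y / \<rho> = grad H z \<bullet> (x - y) / \<rho>" by (simp add: diff_divide_distrib[symmetric])
    ultimately show "\<exists>z\<in>unit_cube. norm (z - x) \<le> norm (y - x) \<and> H x / \<rho> - H y / \<rho> = (grad H z /\<^sub>R \<rho>) \<bullet> (x - y)"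
      by (intro bexI[of _ z]) (simp_all add: divide_inverse_commute)
    assume close: "norm (x - y) \<le> r" and small: "\<bar>H x / \<rho>\<bar> \<le> r" "norm (grad H x /\<^sub>R \<rho>) \<le> r"
    have small': "\<bar>H x\<bar> \<le> r * \<rho>" "norm (grad H x) \<le> r * \<rho>"
      using small \<rho> by (auto simp: abs_divide field_simps)
    show "1 / (2 * K) * norm (x - y) \<le> norm (grad H x /\<^sub>R \<rho> - grad H y /\<^sub>R \<rho>)"
    proof (cases "x = y")
      case False
      define \<xi> where "\<xi> = (x - y) /\<^sub>R norm (x - y)"
      have \<xi>: "norm \<xi> = 1" "x - y = norm (x - y) *\<^sub>R \<xi>" using False by (auto simp: \<xi>_def)
      obtain w where w: "w \<in> unit_cube" "norm (w - x) \<le> norm (y - x)"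
        "grad H x \<bullet> \<xi> - grad H y \<bullet> \<xi> = (x - y) \<bullet> (hess H w *v \<xi>)"
        using unit_cube_mvt[OF C2_cube_derivatives(2)[OF diff(1)] x y] by blast
      have wx: "norm (w - x) \<le> r" using w(2) close by (simp add: norm_minus_commute)
      then have \<rho>wx: "\<rho> * norm (w - x) \<le> r * \<rho>" using \<rho> by (simp add: mult.commute)
      \<comment> \<open>One \<open>r * \<rho>\<close> is the smallness at \<open>x\<close>, the
        other the Lipschitz bound over a distance of at most \<open>r\<close>. Value and gradient
        together use up \<open>4 * (r * \<rho>)\<close>, which the threshold
        \<open>1 / (8 * K)\<close> keeps below half of \<open>\<rho> / K\<close>.\<close>
      have "\<bar>H w\<bar> \<le> 2 * (r * \<rho>)" using est(2)[OF w(1) x] small'(1) \<rho>wx by linarith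
      moreover have "norm (grad H w) \<le> 2 * (r * \<rho>)"
        using est(3)[OF w(1) x] small'(2) \<rho>wx norm_triangle_ineq2[of "grad H w" "grad H x"] by linarith
      ultimately have "\<rho> / K - 4 * (r * \<rho>) \<le> \<bar>\<xi> \<bullet> (hess H w *v \<xi>)\<bar>"
        using lower[OF w(1) \<xi>(1)] by linarith
      moreover have "4 * (r * \<rho>) \<le> \<rho> / (2 * K)"
      proof -
        have "r * \<rho> \<le> 1 / (8 * K) * \<rho>" using \<rho> by (intro mult_right_mono) (auto simp: r_def)
        then show ?thesis by simp
      qed
      moreover have "\<rho> / K = \<rho> / (2 * K) + \<rho> / (2 * K)" by simp
      ultimately have "\<rho> / (2 * K) \<le> \<bar>\<xi> \<bullet> (hess H w *v \<xi>)\<bar>" by linarith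
      then have "norm (x - y) * (\<rho> / (2 * K)) \<le> norm (x - y) * \<bar>\<xi> \<bullet> (hess H w *v \<xi>)\<bar>"
        by (intro mult_left_mono) auto
      also have "\<dots> = \<bar>(grad H x - grad H y) \<bullet> \<xi>\<bar>"
      proof -
        have "(x - y) \<bullet> v = norm (x - y) * (\<xi> \<bullet> v)" for v
          using arg_cong[OF \<xi>(2), of "\<lambda>d. d \<bullet> v"] by (simp only: inner_scaleR_left)
        then show ?thesis unfolding inner_diff_left[of "grad H x"] w(3) by (simp only: abs_mult abs_norm_cancel)
      qed
      also have "\<dots> \<le> norm (grad H x - grad H y)"
        using Cauchy_Schwarz_ineq2[of "grad H x - grad H y" \<xi>] \<xi>(1) by simp
      finally show ?thesis unfolding nd using \<rho> by (simp add: field_simps)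
    qed simp
  qed (use K in \<open>auto simp: r_def\<close>)
  then show ?thesis unfolding H_def \<rho>_def r_def .
qed

text \<open>\<open>\<mu> n\<close> is the number of \<open>f\<close> that meet the covering set
  \<open>n\<close>. Its first moment counts incidences, its second moment counts pairs sharing a
  set.\<close>

lemma incidence_Cauchy_Schwarz:
  fixes T :: "'a \<Rightarrow> 'b set"
  assumes Q: "finite Q" and I: "finite I" and T: "\<And>f. f \<in> Q \<Longrightarrow> T f \<subseteq> I"
  shows "(\<Sum>f\<in>Q. real (card (T f)))\<^sup>2 \<le> real (card I) * (\<Sum>f\<in>Q. \<Sum>g\<in>Q. real (card (T f \<inter> T g)))"
proof -
  define \<mu> where "\<mu> n = (\<Sum>f\<in>Q. of_bool (n \<in> T f) :: real)" for n
  have "real (card (T f \<inter> S)) = (\<Sum>n\<in>I. of_bool (n \<in> T f \<inter> S))" if "f \<in> Q" for f S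
  proof -
    have "I \<inter> {n \<in> T f. n \<in> S} = T f \<inter> S" using T[OF that] by blast
    then show ?thesis using I by (simp add: sum_of_bool_eq)
  qed
  note c = this
  have "(\<Sum>f\<in>Q. real (card (T f))) = (\<Sum>f\<in>Q. \<Sum>n\<in>I. of_bool (n \<in> T f))"
    using c[of _ UNIV] by simp
  also have "\<dots> = (\<Sum>n\<in>I. \<mu> n)" unfolding \<mu>_def by (rule sum.swap)
  finally have "(\<Sum>f\<in>Q. real (card (T f)))\<^sup>2 = (\<Sum>n\<in>I. \<mu> n * 1)\<^sup>2" by simp
  also have "\<dots> \<le> (\<Sum>n\<in>I. (\<mu> n)\<^sup>2) * (\<Sum>n\<in>I. 1\<^sup>2)" by (rule Cauchy_Schwarz_ineq_sum)
  also have "(\<Sum>n\<in>I. (\<mu> n)\<^sup>2) = (\<Sum>n\<in>I. \<Sum>f\<in>Q. \<Sum>g\<in>Q. of_bool (n \<in> T f \<inter> T g))"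
    unfolding \<mu>_def power2_eq_square sum_product by (simp add: of_bool_conj)
  also have "\<dots> = (\<Sum>f\<in>Q. \<Sum>n\<in>I. \<Sum>g\<in>Q. of_bool (n \<in> T f \<inter> T g))" by (rule sum.swap)
  also have "\<dots> = (\<Sum>f\<in>Q. \<Sum>g\<in>Q. \<Sum>n\<in>I. of_bool (n \<in> T f \<inter> T g))"
    by (intro sum.cong refl sum.swap)
  also have "\<dots> = (\<Sum>f\<in>Q. \<Sum>g\<in>Q. real (card (T f \<inter> T g)))"
    by (intro sum.cong refl c[symmetric])
  finally show ?thesis by (simp add: mult.commute)
qed

lemma sum_Un_nonneg_le:
  fixes W :: "'a \<Rightarrow> real"
  assumes "finite A" "finite B" "\<And>x. 0 \<le> W x"
  shows "sum W (A \<union> B) \<le> sum W A + sum W B"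
  using sum.union_inter[OF assms(1,2), of W] sum_nonneg[of "A \<inter> B" W] assms(3) by simp

lemma sum_UN_nonneg_le:
  fixes W :: "'a \<Rightarrow> real"
  assumes "finite I" "\<And>i. finite (S i)" "\<And>x. 0 \<le> W x"
  shows "sum W (\<Union>i\<in>I. S i) \<le> (\<Sum>i\<in>I. sum W (S i))"
  using assms(1)
proof induction
  case (insert i I)
  have "sum W (\<Union>i\<in>insert i I. S i) \<le> sum W (S i) + sum W (\<Union>i\<in>I. S i)"
    using sum_Un_nonneg_le[of "S i" "\<Union>i\<in>I. S i" W] insert assms by simp
  with insert show ?case by simp
qed simp

text \<open>Ball growth and decay of \<open>V\<close> have the same exponent \<open>u\<close>, so
  every annulus contributes at most \<open>4 * A\<close>: there are at most
  \<open>2 * (2 ^ Suc l) powr u\<close> elements, each of weight at most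
  \<open>A * ((1/2) ^ l) powr u\<close>. The \<open>k + k1 + 1\<close> annuli reach from
  \<open>\<delta>\<close> to \<open>2 ^ k1\<close>.\<close>

lemma dyadic_annuli_sum_le:
  fixes V \<rho> :: "'a \<Rightarrow> real"
  assumes Q: "finite Q" and A: "0 \<le> A" and \<delta>: "\<delta> = (1/2) ^ k" and u: "0 < u" "u \<le> 1"
    and ball: "\<And>r. \<delta> \<le> r \<Longrightarrow> real (card {g\<in>Q. \<rho> g \<le> r}) \<le> 2 * (r / \<delta>) powr u"
    and \<rho>: "\<And>g. g \<in> Q \<Longrightarrow> \<rho> g \<le> 2 ^ k1"
    and V: "\<And>g. g \<in> Q \<Longrightarrow> V g \<le> A" "\<And>g. g \<in> Q \<Longrightarrow> \<delta> < \<rho> g \<Longrightarrow> V g \<le> A * (\<delta> / \<rho> g) powr u"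
  shows "(\<Sum>g\<in>Q. V g) \<le> 8 * A * (1 + real k1) * (real k + 1)"
proof -
  have \<delta>0: "0 < \<delta>" using \<delta> by simp
  define Q0 where "Q0 = {g\<in>Q. \<rho> g \<le> \<delta>}"
  define S where "S l = {g\<in>Q. \<delta> < \<rho> g \<and> (1/2) ^ Suc l < \<delta> / \<rho> g \<and> \<delta> / \<rho> g \<le> (1/2) ^ l}" for l
  define W where "W = (\<lambda>g. max 0 (V g))"
  have W: "W g \<le> A" "\<delta> < \<rho> g \<Longrightarrow> W g \<le> A * (\<delta> / \<rho> g) powr u" if "g \<in> Q" for g
    using V[OF that] A by (auto simp: W_def)
  have fin: "finite Q0" "finite (S l)" for l using Q by (auto simp: Q0_def S_def)
  have sub: "Q \<subseteq> Q0 \<union> (\<Union>l\<in>{..k + k1}. S l)"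
  proof
    fix g assume g: "g \<in> Q"
    show "g \<in> Q0 \<union> (\<Union>l\<in>{..k + k1}. S l)"
    proof (cases "\<rho> g \<le> \<delta>")
      case False
      then have *: "0 < \<delta> / \<rho> g" "\<delta> / \<rho> g \<le> 1" using \<delta>0 by auto
      obtain l where l: "(1/2) ^ Suc l < \<delta> / \<rho> g" "\<delta> / \<rho> g \<le> (1/2) ^ l" using dyadic_scale[OF *] by blast
      have "(1/2) ^ (k + k1) = \<delta> / 2 ^ k1" by (simp add: \<delta> power_add power_one_over)
      also have "\<dots> \<le> \<delta> / \<rho> g" using \<rho>[OF g] False \<delta>0 by (intro divide_left_mono) auto
      finally have "(1/2::real) ^ (k + k1) \<le> (1/2) ^ l" using l by linarith
      then have "l \<le> k + k1" by (simp add: power_decreasing_iff)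
      then show ?thesis using l g False by (auto simp: S_def)
    qed (use g in \<open>auto simp: Q0_def\<close>)
  qed
  have "real (card Q0) \<le> 2" using ball[of \<delta>] \<delta>0 by (simp add: Q0_def)
  moreover have "(\<Sum>g\<in>Q0. W g) \<le> real (card Q0) * A"
    by (rule sum_bounded_above) (simp add: W(1) Q0_def)
  ultimately have "(\<Sum>g\<in>Q0. W g) \<le> 2 * A" using A mult_right_mono by (meson order_trans)
  then have Q0: "(\<Sum>g\<in>Q0. W g) \<le> 4 * A" using A by linarith
  have Sl: "(\<Sum>g\<in>S l. W g) \<le> 4 * A" for l
  proof -
    have "S l \<subseteq> {g\<in>Q. \<rho> g \<le> 2 ^ Suc l * \<delta>}"
    proof
      fix g assume g: "g \<in> S l"
      then have "0 < \<rho> g" "(1/2) ^ Suc l < \<delta> / \<rho> g" using \<delta>0 by (auto simp: S_def)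
      then have "\<rho> g < 2 ^ Suc l * \<delta>" by (simp add: field_simps power_one_over)
      then show "g \<in> {g\<in>Q. \<rho> g \<le> 2 ^ Suc l * \<delta>}" using g by (auto simp: S_def)
    qed
    then have "card (S l) \<le> card {g\<in>Q. \<rho> g \<le> 2 ^ Suc l * \<delta>}" using Q by (intro card_mono) auto
    moreover have "\<delta> \<le> 2 ^ Suc l * \<delta>" using \<delta>0 mult_right_mono[of 1 "2 ^ Suc l" \<delta>] by (simp del: power_Suc)
    ultimately have cS: "real (card (S l)) \<le> 2 * (2 ^ Suc l) powr u" using ball[of "2 ^ Suc l * \<delta>"] \<delta>0 by simp
    have WS: "W g \<le> A * ((1/2) ^ l) powr u" if "g \<in> S l" for g
    proof -
      have "W g \<le> A * (\<delta> / \<rho> g) powr u" using that W(2) by (auto simp: S_def)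
      also have "\<dots> \<le> A * ((1/2) ^ l) powr u"
        using that A u \<delta>0 by (intro mult_left_mono powr_mono2) (auto simp: S_def)
      finally show ?thesis .
    qed
    have "(\<Sum>g\<in>S l. W g) \<le> real (card (S l)) * (A * ((1/2) ^ l) powr u)"
      using WS by (rule sum_bounded_above)
    also have "\<dots> \<le> (2 * (2 ^ Suc l) powr u) * (A * ((1/2) ^ l) powr u)"
      using cS A by (intro mult_right_mono) auto
    also have "\<dots> = 2 * A * (2 ^ Suc l * (1/2) ^ l) powr u" by (simp add: powr_mult mult_ac del: power_Suc)
    also have "2 ^ Suc l * (1/2::real) ^ l = 2" by (simp add: power_one_over)
    also have "2 * A * 2 powr u \<le> 2 * A * 2 powr 1" using A u by (intro mult_left_mono powr_mono) auto
    finally show ?thesis by simp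
  qed
  have "(\<Sum>g\<in>Q. V g) \<le> (\<Sum>g\<in>Q. W g)" by (intro sum_mono) (simp add: W_def)
  also have "\<dots> \<le> (\<Sum>g\<in>Q0 \<union> (\<Union>l\<in>{..k + k1}. S l). W g)"
    using sub fin by (intro sum_mono2) (auto simp: W_def)
  also have "\<dots> \<le> (\<Sum>g\<in>Q0. W g) + (\<Sum>g\<in>(\<Union>l\<in>{..k + k1}. S l). W g)"
    using fin by (intro sum_Un_nonneg_le) (auto simp: W_def)
  also have "(\<Sum>g\<in>(\<Union>l\<in>{..k + k1}. S l). W g) \<le> (\<Sum>l\<in>{..k + k1}. \<Sum>g\<in>S l. W g)"
    using fin by (intro sum_UN_nonneg_le) (auto simp: W_def)
  also have "(\<Sum>g\<in>Q0. W g) + (\<Sum>l\<in>{..k + k1}. \<Sum>g\<in>S l. W g) \<le> 4 * A + (\<Sum>l\<in>{..k + k1}. 4 * A)"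
    by (intro add_mono sum_mono Sl Q0)
  also have "4 * A + (\<Sum>l\<in>{..k + k1}. 4 * A) = (4 * A) * (real k + real k1 + 2)" by (simp add: algebra_simps)
  also have "\<dots> \<le> (4 * A) * (2 * (1 + real k1) * (real k + 1))"
    using A by (intro mult_left_mono) (auto simp: algebra_simps)
  finally show ?thesis by (simp add: mult_ac)
qed

text \<open>Up to a logarithm, two members at distance \<open>\<rho>\<close> share at most a
  constant times \<open>(\<delta> / \<rho>) powr u * \<delta> powr - m\<close> covering sets;
  \<open>u \<le> s\<close> allows decay of exponent \<open>s\<close> to be weakened to match the
  ball growth of \<open>Q\<close>. The constant \<open>A\<close> is fixed before the scale, so the
  scale may be chosen depending on it.\<close>

lemma discretized_incidence_bound:
  fixes F :: "(real^'n \<Rightarrow> real) set"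
  assumes cin: "cinematic F K D \<alpha>" and n: "2 \<le> CARD('n)" and s: "s \<le> 1" and u: "0 < u" "u \<le> s"
    and m: "m = real CARD('n) - 1 + s"
  obtains A where "0 < A"
    "\<And>k I C Q P a b. \<lbrakk>finite (I :: nat set); \<And>n p q. n \<in> I \<Longrightarrow> p \<in> C n \<Longrightarrow> q \<in> C n \<Longrightarrow> dist p q \<le> (1/2) ^ k;
       finite Q; Q \<subseteq> F; Q \<noteq> {};
       \<And>f r. f \<in> Q \<Longrightarrow> (1/2) ^ k \<le> r \<Longrightarrow> real (card {g\<in>Q. c2dist f g \<le> r}) \<le> 2 * (r / (1/2) ^ k) powr u;
       \<And>f. f \<in> Q \<Longrightarrow> finite (P f); \<And>f. f \<in> Q \<Longrightarrow> P f \<subseteq> unit_cube;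
       \<And>f x r. f \<in> Q \<Longrightarrow> x \<in> P f \<Longrightarrow> (1/2) ^ k \<le> r \<Longrightarrow> real (card {p\<in>P f. dist x p \<le> r}) \<le> 2 * (r / (1/2) ^ k) powr m;
       \<And>f x. f \<in> Q \<Longrightarrow> x \<in> P f \<Longrightarrow> (x, f x) \<in> (\<Union>n\<in>I. C n);
       0 \<le> a; a \<le> ((1/2) ^ k) powr u * real (card Q); 0 \<le> b;
       \<And>f. f \<in> Q \<Longrightarrow> b \<le> ((1/2) ^ k) powr m * real (card (P f))\<rbrakk>
     \<Longrightarrow> a * b\<^sup>2 \<le> A * (real k + 1)\<^sup>2 * real (card I) * ((1/2) ^ k) powr (u + m)"
proof -
  have K: "0 < K" by (rule cinematic_K_pos[OF cin])
  have F2: "F \<subseteq> C2_cube" using cin unfolding cinematic_def by blast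
  obtain h where h: "h \<in> C2_cube" "\<And>f. f \<in> F \<Longrightarrow> c2dist h f \<le> K / 2"
  proof -
    have "\<exists>h\<in>C2_cube. \<forall>f\<in>F. c2dist h f \<le> K / 2" using cin unfolding cinematic_def by (elim conjE)
    then show ?thesis using that by blast
  qed
  note dK = cinematic_c2dist_le[OF cin]
  \<comment> \<open>The centre \<open>h\<close> of a ball containing \<open>F\<close> yields a
    Lipschitz constant common to all members.\<close>
  define L where "L = c2norm h + K"
  have hn: "0 \<le> c2norm h" by (rule c2normE[OF h(1)]) simp
  have L: "K \<le> L" "0 < L" using hn K by (auto simp: L_def)
  have Lip: "\<bar>f x - f y\<bar> \<le> L * norm (x - y)" if "f \<in> F" "x \<in> unit_cube" "y \<in> unit_cube" for f x y
  proof -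
    have f2: "f \<in> C2_cube" using that F2 by auto
    note C2_cube_estimates(2)[OF h(1) that(2,3)] C2_cube_estimates(2)[OF C2_cube_diff(1)[OF h(1) f2] that(2,3)]
    moreover have "c2norm (\<lambda>x. h x - f x) * norm (x - y) \<le> K * norm (x - y)"
      using h(2)[OF that(1)] K by (intro mult_right_mono) (auto simp: c2dist_def)
    ultimately show ?thesis unfolding L_def distrib_right by linarith
  qed
  define r0 where "r0 = min 1 (1 / (8 * K))"
  define dm where "dm = real CARD('n)"
  have dm: "2 \<le> dm" using n by (simp add: dm_def)
  have m0: "0 < m" using m dm u s unfolding dm_def[symmetric] by linarith
  define KZ where "KZ = nondegenerate.KC TYPE('n) (1 / (2 * K)) r0 r0 dm m"
  obtain k1 where k1: "K < 2 ^ k1" using real_arch_pow[of 2 K] by auto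
  define A1 where "A1 = (2 * dm powr m + \<bar>KZ\<bar>) * (1 + L) powr u"
  have A1: "0 < A1" using dm L unfolding A1_def by (intro mult_pos_pos add_pos_nonneg) auto
  have L1: "1 \<le> (1 + L) powr u" using L u by (intro ge_one_powr_ge_zero) auto
  define A where "A = 4 * (8 * A1 * (1 + real k1))"
  show ?thesis
  proof
    show "0 < A" using A1 by (simp add: A_def)
    fix k a b and I :: "nat set" and C :: "nat \<Rightarrow> ((real^'n) \<times> real) set" and Q P
    assume I: "finite I" "\<And>n p q. n \<in> I \<Longrightarrow> p \<in> C n \<Longrightarrow> q \<in> C n \<Longrightarrow> dist p q \<le> (1/2) ^ k"
      and Q: "finite Q" "Q \<subseteq> F" "Q \<noteq> {}"
      "\<And>f r. f \<in> Q \<Longrightarrow> (1/2) ^ k \<le> r \<Longrightarrow> real (card {g\<in>Q. c2dist f g \<le> r}) \<le> 2 * (r / (1/2) ^ k) powr u"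
      and P: "\<And>f. f \<in> Q \<Longrightarrow> finite (P f)" "\<And>f. f \<in> Q \<Longrightarrow> P f \<subseteq> unit_cube"
       "\<And>f x r. f \<in> Q \<Longrightarrow> x \<in> P f \<Longrightarrow> (1/2) ^ k \<le> r \<Longrightarrow> real (card {p\<in>P f. dist x p \<le> r}) \<le> 2 * (r / (1/2) ^ k) powr m"
       "\<And>f x. f \<in> Q \<Longrightarrow> x \<in> P f \<Longrightarrow> (x, f x) \<in> (\<Union>n\<in>I. C n)"
      and ab: "0 \<le> a" "a \<le> ((1/2) ^ k) powr u * real (card Q)" "0 \<le> b"
       "\<And>f. f \<in> Q \<Longrightarrow> b \<le> ((1/2) ^ k) powr m * real (card (P f))"
    define \<delta> where "\<delta> = (1/2::real) ^ k"
    have \<delta>: "0 < \<delta>" "\<delta> \<le> 1" by (auto simp: \<delta>_def power_le_one)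
    note I = I[folded \<delta>_def] and Q = Q[folded \<delta>_def] and P = P[folded \<delta>_def] and ab = ab[folded \<delta>_def]
    have "\<forall>f x. \<exists>n. f \<in> Q \<longrightarrow> x \<in> P f \<longrightarrow> n \<in> I \<and> (x, f x) \<in> C n" using P(4) by blast
    then obtain \<nu> where \<nu>: "\<And>f x. f \<in> Q \<Longrightarrow> x \<in> P f \<Longrightarrow> \<nu> f x \<in> I \<and> (x, f x) \<in> C (\<nu> f x)" by metis
    define T where "T f = \<nu> f ` P f" for f
    have distP: "dist x y \<le> \<delta> \<and> \<bar>f x - g y\<bar> \<le> \<delta>"
      if "f \<in> Q" "x \<in> P f" "g \<in> Q" "y \<in> P g" "\<nu> f x = \<nu> g y" for f x g y
    proof -
      have "(x, f x) \<in> C (\<nu> f x)" "(y, g y) \<in> C (\<nu> f x)" "\<nu> f x \<in> I" using \<nu> that by metis+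
      then have "dist (x, f x) (y, g y) \<le> \<delta>" using I(2) by blast
      then show ?thesis using dist_fst_le[of "(x, f x)" "(y, g y)"] dist_snd_le[of "(x, f x)" "(y, g y)"]
        by (auto simp: dist_real_def)
    qed
    \<comment> \<open>A covering set has diameter at most \<open>\<delta>\<close>, and the ball
      condition at radius \<open>\<delta>\<close> allows only two points of \<open>P f\<close> to
      share it.\<close>
    have PT: "real (card (P f)) \<le> 2 * real (card (T f))" if f: "f \<in> Q" for f
    proof -
      have "real (card (P f)) \<le> real (card (\<nu> f ` P f)) * 2"
      proof (rule card_le_image_times_fibre[OF P(1)[OF f]])
        fix x assume x: "x \<in> P f"
        have "card {y \<in> P f. \<nu> f y = \<nu> f x} \<le> card {y \<in> P f. dist x y \<le> \<delta>}"
          using P(1)[OF f] distP[OF f x f] by (intro card_mono) auto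
        then show "real (card {y \<in> P f. \<nu> f y = \<nu> f x}) \<le> 2" using P(3)[OF f x, of \<delta>] \<delta> by simp
      qed simp
      then show ?thesis by (simp add: T_def)
    qed
    define V where "V f g = real (card (T f \<inter> T g))" for f g
    have V_le: "V f g \<le> real (card {x\<in>P f. \<bar>f x - g x\<bar> \<le> (1 + L) * \<delta>})" if fg: "f \<in> Q" "g \<in> Q" for f g
    proof -
      \<comment> \<open>If a set is met by the graph of \<open>f\<close> over \<open>x\<close> and
        by that of \<open>g\<close> over \<open>y\<close>, replacing \<open>g y\<close> by
        \<open>g x\<close> costs at most \<open>L * \<delta>\<close>.\<close>
      have "T f \<inter> T g \<subseteq> \<nu> f ` {x\<in>P f. \<bar>f x - g x\<bar> \<le> (1 + L) * \<delta>}"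
      proof
        fix n assume "n \<in> T f \<inter> T g"
        then obtain x y where xy: "x \<in> P f" "n = \<nu> f x" "y \<in> P g" "n = \<nu> g y" by (auto simp: T_def)
        have d: "dist x y \<le> \<delta>" "\<bar>f x - g y\<bar> \<le> \<delta>" using distP[OF fg(1) xy(1) fg(2) xy(3)] xy by auto
        have "\<bar>g y - g x\<bar> \<le> L * norm (y - x)" using Lip xy fg P(2) Q(2) by blast
        also have "\<dots> \<le> L * \<delta>" using d L by (intro mult_left_mono) (auto simp: dist_norm norm_minus_commute)
        finally have "\<bar>f x - g x\<bar> \<le> (1 + L) * \<delta>" using d by (simp add: distrib_right)
        then show "n \<in> \<nu> f ` {x\<in>P f. \<bar>f x - g x\<bar> \<le> (1 + L) * \<delta>}" using xy by auto
      qed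
      then have "card (T f \<inter> T g) \<le> card (\<nu> f ` {x\<in>P f. \<bar>f x - g x\<bar> \<le> (1 + L) * \<delta>})"
        using P(1)[OF fg(1)] by (intro card_mono) auto
      also have "\<dots> \<le> card {x\<in>P f. \<bar>f x - g x\<bar> \<le> (1 + L) * \<delta>}" using P(1)[OF fg(1)] by (intro card_image_le) auto
      finally show ?thesis by (simp add: V_def)
    qed
    have triv: "V f g \<le> 2 * dm powr m * \<delta> powr - m" if fg: "f \<in> Q" "g \<in> Q" for f g
    proof (cases "P f = {}")
      case True
      then show ?thesis by (simp add: V_def T_def)
    next
      case False
      then obtain x where x: "x \<in> P f" by blast
      have "dist x y \<le> dm" if "y \<in> P f" for y
        using dist_unit_cube_le x that P(2)[OF fg(1)] unfolding dm_def by blast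
      then have "{p\<in>P f. dist x p \<le> dm} = P f" by blast
      then have "real (card (P f)) \<le> 2 * (dm / \<delta>) powr m"
        using P(3)[OF fg(1) x, of dm] \<delta> dm by simp
      moreover have "card {x\<in>P f. \<bar>f x - g x\<bar> \<le> (1 + L) * \<delta>} \<le> card (P f)" using P(1)[OF fg(1)] by (intro card_mono) auto
      ultimately have "V f g \<le> 2 * (dm / \<delta>) powr m" using V_le[OF fg] by linarith
      then show ?thesis using \<delta> dm by (simp add: powr_divide powr_minus_divide)
    qed
    let ?A = "A1 * (real k + 1) * \<delta> powr - m"
    have A0: "0 \<le> ?A" using A1 by simp
    have trivA: "(2 * dm powr m) * (1 + L) powr u * \<delta> powr - m \<le> ?A"
    proof (rule mult_right_mono)
      have "(2 * dm powr m) * (1 + L) powr u \<le> A1" unfolding A1_def by (intro mult_right_mono) auto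
      also have "\<dots> \<le> A1 * (real k + 1)" using A1 by simp
      finally show "(2 * dm powr m) * (1 + L) powr u \<le> A1 * (real k + 1)" .
    qed simp
    have V1: "V f g \<le> ?A" if fg: "f \<in> Q" "g \<in> Q" for f g
    proof -
      have "2 * dm powr m * 1 * \<delta> powr - m \<le> (2 * dm powr m) * (1 + L) powr u * \<delta> powr - m"
        using L1 by (intro mult_right_mono mult_left_mono) auto
      then show ?thesis using triv[OF fg] trivA by simp
    qed
    have V2: "V f g \<le> ?A * (\<delta> / c2dist f g) powr u" if fg: "f \<in> Q" "g \<in> Q" and far: "\<delta> < c2dist f g" for f g
    proof -
      define \<rho> where "\<rho> = c2dist f g"
      have \<rho>: "0 < \<rho>" "\<delta> < \<rho>" using far \<delta> by (auto simp: \<rho>_def)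
      \<comment> \<open>Dividing \<open>f - g\<close> by \<open>\<rho>\<close> turns the tolerance
        \<open>(1 + L) * \<delta>\<close> into \<open>\<epsilon>\<close>. When
        \<open>\<epsilon> > 1\<close> the trivial count suffices, because then
        \<open>\<epsilon> powr u \<ge> 1\<close>.\<close>
      define \<epsilon> where "\<epsilon> = (1 + L) * \<delta> / \<rho>"
      have \<epsilon>0: "0 < \<epsilon>" using L \<delta> \<rho> by (simp add: \<epsilon>_def)
      have \<epsilon>u: "\<epsilon> powr u = (1 + L) powr u * (\<delta> / \<rho>) powr u"
        unfolding \<epsilon>_def using L \<delta> \<rho> by (simp add: powr_mult powr_divide)
      have "V f g \<le> (2 * dm powr m + \<bar>KZ\<bar>) * (real k + 1) * (\<epsilon> powr u * \<delta> powr - m)"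
      proof (cases "\<epsilon> \<le> 1")
        case False
        then have "1 \<le> \<epsilon> powr u" using u by (intro ge_one_powr_ge_zero) auto
        then have "2 * dm powr m * 1 * (1 * \<delta> powr - m) \<le>
            (2 * dm powr m + \<bar>KZ\<bar>) * (real k + 1) * (\<epsilon> powr u * \<delta> powr - m)"
          by (intro mult_mono) auto
        then show ?thesis using triv[OF fg] by simp
      next
        case True
        have fgF: "f \<in> F" "g \<in> F" using fg Q by auto
        interpret nondegenerate unit_cube "\<lambda>x. (f x - g x) / \<rho>" "\<lambda>x. grad (\<lambda>x. f x - g x) x /\<^sub>R \<rho>"
          "1 / (2 * K)" r0 r0 dm
          using cinematic_nondegenerate[OF cin fgF] \<rho> unfolding \<rho>_def r0_def dm_def by blast
        have "\<rho> \<le> 1 + L" using dK[OF fgF] L by (simp add: \<rho>_def)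
        then have "\<delta> \<le> \<epsilon>"
          using \<rho> \<delta> mult_right_mono[of \<rho> "1 + L" \<delta>] unfolding \<epsilon>_def by (simp add: pos_le_divide_eq mult.commute)
        then have "real (card {p\<in>P f. \<bar>(f p - g p) / \<rho>\<bar> \<le> \<epsilon>}) \<le> KZ * (real k + 1) * (\<epsilon> powr s * \<delta> powr - m)"
          unfolding KZ_def
          using P(1-3)[OF fg(1)] \<delta> True m0 n u s m
          by (intro card_near_zero_set_le) (auto simp: \<delta>_def dm_def)
        moreover have "{p\<in>P f. \<bar>(f p - g p) / \<rho>\<bar> \<le> \<epsilon>} = {x\<in>P f. \<bar>f x - g x\<bar> \<le> (1 + L) * \<delta>}"
          using \<rho> unfolding \<epsilon>_def by (auto simp: abs_divide divide_le_cancel)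
        ultimately have "V f g \<le> KZ * (real k + 1) * (\<epsilon> powr s * \<delta> powr - m)" using V_le[OF fg] by simp
        also have "\<dots> \<le> (2 * dm powr m + \<bar>KZ\<bar>) * (real k + 1) * (\<epsilon> powr u * \<delta> powr - m)"
        proof (intro mult_mono)
          show "\<epsilon> powr s \<le> \<epsilon> powr u" using \<epsilon>0 True u by (intro powr_mono') auto
        qed (auto intro: add_increasing)
        finally show ?thesis .
      qed
      also have "\<dots> = ?A * (\<delta> / \<rho>) powr u" unfolding A1_def \<epsilon>u by (simp only: mult_ac)
      finally show ?thesis by (simp only: \<rho>_def)
    qed
    have SV: "(\<Sum>g\<in>Q. V f g) \<le> 8 * ?A * (1 + real k1) * (real k + 1)" if f: "f \<in> Q" for f
    proof (rule dyadic_annuli_sum_le[OF Q(1) A0 \<delta>_def, of u "c2dist f"])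
      show "c2dist f g \<le> 2 ^ k1" if "g \<in> Q" for g using dK[of f g] k1 f that Q(2) by fastforce
    qed (use u s Q(4) V1 V2 f in auto)
    define M where "M = real (card Q)"
    have M0: "0 < M" using Q by (simp add: M_def card_gt_0_iff)
    have T_low: "b * \<delta> powr - m / 2 \<le> real (card (T f))" if f: "f \<in> Q" for f
    proof -
      have "b * \<delta> powr - m \<le> (\<delta> powr m * real (card (P f))) * \<delta> powr - m"
        using ab(4)[OF f] by (intro mult_right_mono) auto
      also have "\<dots> = real (card (P f))" using \<delta> by (simp add: powr_minus_divide)
      finally show ?thesis using PT[OF f] by linarith
    qed
    have "M * (b * \<delta> powr - m / 2) = (\<Sum>f\<in>Q. b * \<delta> powr - m / 2)" by (simp add: M_def)
    also have "\<dots> \<le> (\<Sum>f\<in>Q. real (card (T f)))" by (intro sum_mono T_low)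
    finally have "(M * (b * \<delta> powr - m / 2))\<^sup>2 \<le> (\<Sum>f\<in>Q. real (card (T f)))\<^sup>2"
      using M0 ab by (intro power_mono) auto
    also have "\<dots> \<le> real (card I) * (\<Sum>f\<in>Q. \<Sum>g\<in>Q. V f g)"
      unfolding V_def by (rule incidence_Cauchy_Schwarz[OF Q(1) I(1)]) (use \<nu> in \<open>auto simp: T_def\<close>)
    also have "\<dots> \<le> real (card I) * (\<Sum>f\<in>Q. 8 * ?A * (1 + real k1) * (real k + 1))"
      by (intro mult_left_mono sum_mono SV) auto
    also have "\<dots> = M * (real (card I) * (8 * ?A * (1 + real k1) * (real k + 1)))" by (simp add: M_def)
    \<comment> \<open>Each of the \<open>M\<close> members has the same bound on the right, so one
      factor \<open>M\<close> cancels; the other is bounded below through \<open>a\<close>.\<close>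
    finally have "M * (M * (b * \<delta> powr - m / 2)\<^sup>2) \<le> M * (real (card I) * (8 * ?A * (1 + real k1) * (real k + 1)))"
      by (simp only: power_mult_distrib power2_eq_square mult_ac)
    then have "M * (b * \<delta> powr - m / 2)\<^sup>2 \<le> real (card I) * (8 * ?A * (1 + real k1) * (real k + 1))"
      using M0 mult_le_cancel_left_pos by blast
    then have "4 * (M * (b * \<delta> powr - m / 2)\<^sup>2) \<le> 4 * (real (card I) * (8 * ?A * (1 + real k1) * (real k + 1)))"
      by (rule mult_left_mono) simp
    also have "\<dots> = A * (real k + 1)\<^sup>2 * real (card I) * \<delta> powr - m"
      unfolding A_def by (simp only: power2_eq_square mult_ac)
    also have "4 * (M * (b * \<delta> powr - m / 2)\<^sup>2) = M * b\<^sup>2 * (\<delta> powr - m)\<^sup>2"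
      by (simp add: power_mult_distrib power_divide)
    finally have main: "M * b\<^sup>2 * (\<delta> powr - m)\<^sup>2 \<le> A * (real k + 1)\<^sup>2 * real (card I) * \<delta> powr - m" .
    have "a * b\<^sup>2 \<le> (\<delta> powr u * M) * b\<^sup>2" using ab by (intro mult_right_mono) (auto simp: M_def)
    also have "\<dots> = (M * b\<^sup>2 * (\<delta> powr - m)\<^sup>2) * (\<delta> powr u * (\<delta> powr m)\<^sup>2)"
      using \<delta> by (simp add: powr_minus_divide power_divide)
    also have "\<dots> \<le> (A * (real k + 1)\<^sup>2 * real (card I) * \<delta> powr - m) * (\<delta> powr u * (\<delta> powr m)\<^sup>2)"
      using main by (rule mult_right_mono) auto
    also have "\<dots> = A * (real k + 1)\<^sup>2 * real (card I) * \<delta> powr (u + m)"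
      using \<delta> by (simp add: powr_minus_divide powr_add power2_eq_square)
    finally show "a * b\<^sup>2 \<le> A * (real k + 1)\<^sup>2 * real (card I) * ((1/2) ^ k) powr (u + m)"
      by (simp add: \<delta>_def)
  qed
qed

section \<open>Proof of the theorem\<close>

lemma square_times_power_limit_0:
  assumes "0 < x" "x < (1::real)"
  shows "(\<lambda>k. (real k + 1)\<^sup>2 * x ^ k) \<longlonglongrightarrow> 0"
proof -
  define y where "y = sqrt x"
  have y: "0 < y" "y < 1" "x = y\<^sup>2" using assms by (auto simp: y_def)
  have "(\<lambda>k. (real k * y ^ k + y ^ k)\<^sup>2) \<longlonglongrightarrow> (0 + 0)\<^sup>2"
    using y by (intro tendsto_power tendsto_add powser_times_n_limit_0 LIMSEQ_power_zero) auto
  moreover have "(real k * y ^ k + y ^ k)\<^sup>2 = (real k + 1)\<^sup>2 * x ^ k" for k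
    by (simp add: y(3) distrib_right[of "real k" 1, simplified, symmetric] power_mult_distrib power_mult[symmetric] mult.commute)
  ultimately show ?thesis by simp
qed

lemma ennreal_pos_lower:
  assumes "0 < (x::ennreal)" obtains a where "0 < a" "ennreal a \<le> x"
proof (cases x)
  case (real r)
  then show ?thesis using assms that[of r] by simp
next
  case top
  then show ?thesis using that[of 1] by simp
qed

lemma hausdorff_measure_neq_0:
  assumes "ereal t \<le> hdim d A" "0 \<le> u" "u < t"
  shows "hausdorff_measure d u A \<noteq> 0"
proof
  assume "hausdorff_measure d u A = 0"
  then have "hdim d A \<le> ereal u" unfolding hdim_def using assms(2) by (intro Inf_lower) blast
  with assms show False by (meson ereal_less_eq(3) less_le_not_le order_trans)
qed

text \<open>Each index in \<open>I\<close> costs at least \<open>\<rho> powr \<sigma>\<close> of a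
  total below 1. Testing this on finite subsets also gives finiteness.\<close>

lemma card_scale_class:
  fixes r :: "nat \<Rightarrow> real"
  assumes r: "\<And>n. 0 < r n" and sum: "(\<Sum>n. ennreal (r n powr \<sigma>)) < 1" and \<sigma>: "0 < \<sigma>" and I: "\<And>n. n \<in> I \<Longrightarrow> \<rho> \<le> r n" and \<rho>: "0 < \<rho>"
  shows "finite I" "real (card I) * \<rho> powr \<sigma> \<le> 1"
proof -
  have J: "real (card J) * \<rho> powr \<sigma> \<le> 1" if "finite J" "J \<subseteq> I" for J
  proof -
    have "ennreal (real (card J) * \<rho> powr \<sigma>) = (\<Sum>n\<in>J. ennreal (\<rho> powr \<sigma>))"
      by (simp add: ennreal_mult' ennreal_of_nat_eq_real_of_nat)
    also have "\<dots> \<le> (\<Sum>n\<in>J. ennreal (r n powr \<sigma>))"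
      using that I \<rho> \<sigma> by (intro sum_mono ennreal_leI powr_mono2) auto
    also have "\<dots> \<le> (\<Sum>n. ennreal (r n powr \<sigma>))" by (rule sum_le_suminf) (auto intro: that summableI)
    also have "\<dots> \<le> ennreal 1" using sum by (simp add: less_imp_le)
    finally show ?thesis by (subst (asm) ennreal_le_iff) simp_all
  qed
  show fin: "finite I"
  proof (rule ccontr)
    assume "infinite I"
    define N where "N = nat \<lceil>1 / \<rho> powr \<sigma>\<rceil> + 1"
    obtain J where "J \<subseteq> I" "finite J" "card J = N" using infinite_arbitrarily_large[OF \<open>infinite I\<close>] by blast
    with J have "real N * \<rho> powr \<sigma> \<le> 1" by blast
    then have "real N \<le> 1 / \<rho> powr \<sigma>" using \<rho> by (simp add: field_simps)
    then show False unfolding N_def by linarith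
  qed
  show "real (card I) * \<rho> powr \<sigma> \<le> 1" using J[OF fin] by simp
qed

lemma half_power_powr: "((1/2::real) ^ k) powr a = 2 powr (- (a * real k))"
proof -
  have "(1/2::real) ^ k = 2 powr - real k"
    by (simp add: powr_minus powr_realpow power_one_over inverse_eq_divide)
  then show ?thesis by (simp only: powr_powr) (simp add: mult.commute)
qed

theorem theorem1p12:
  fixes E :: "((real^'n) \<times> real) set" and F :: "(real^'n \<Rightarrow> real) set" and s t :: real
  assumes "CARD('n) \<ge> 2"
    and "0 < s" and "s \<le> 1" and "0 < t" and "t \<le> 1"
    and "furstenberg (real CARD('n) - 1 + s) t F E"
  shows "hdim dist E \<ge> ereal (real CARD('n) - 1 + s + min t s)"
proof (rule ccontr)
  \<comment> \<open>\<open>CARD('n)\<close> is the dimension n - 1 of the cube, so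
    \<open>dm - 1\<close> is the n - 2 of the English statement.\<close>
  define dm where "dm = real CARD('n)"
  have dm: "2 \<le> dm" using assms(1) by (simp add: dm_def)
  define \<tau> where "\<tau> = dm - 1 + s + min t s"
  assume "\<not> hdim dist E \<ge> ereal (real CARD('n) - 1 + s + min t s)"
  then have "hdim dist E < ereal \<tau>" by (simp add: \<tau>_def dm_def not_le)
  then obtain \<sigma>0 where \<sigma>0: "0 \<le> \<sigma>0" "hausdorff_measure dist \<sigma>0 E = 0" "\<sigma>0 < \<tau>"
    unfolding hdim_def Inf_less_iff by auto
  obtain K D \<alpha> where F: "F \<subseteq> C2_cube_unit" and cin: "cinematic F K D \<alpha>" and dimF: "ereal t \<le> hdim c2dist F"
    and dimE: "\<And>f. f \<in> F \<Longrightarrow> ereal (dm - 1 + s) \<le> hdim dist (E \<inter> graph_cube f)"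
    using assms(6) unfolding furstenberg_def cinematic_family_def dm_def by blast
  have F2: "F \<subseteq> C2_cube" using F by (auto simp: C2_cube_unit_def)
  \<comment> \<open>Exponent budget: \<open>u + m = \<tau> - 3 * \<gamma>\<close>, and pigeonholing
    costs another \<open>3 * \<gamma>\<close>, so \<open>\<sigma>\<close> must stay below
    \<open>\<tau> - 6 * \<gamma>\<close>. The first entry of the minimum ensures this for
    \<open>\<sigma>0\<close>, the second for \<open>dm - 1\<close>.\<close>
  define \<gamma> where "\<gamma> = min ((\<tau> - \<sigma>0) / 8) (min t s / 4)"
  define s' u m where "s' = s - \<gamma>" and "u = min t s - 2 * \<gamma>" and "m = dm - 1 + s'"
  \<comment> \<open>\<open>\<sigma>0\<close> may be 0, whereas the covering arguments below ask for
    a positive exponent.\<close>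
  define \<sigma> where "\<sigma> = max \<sigma>0 (dm - 1)"
  have \<gamma>: "0 < \<gamma>" "8 * \<gamma> \<le> \<tau> - \<sigma>0" "4 * \<gamma> \<le> t" "4 * \<gamma> \<le> s" "4 * \<gamma> \<le> min t s"
  proof -
    show "0 < \<gamma>" using \<sigma>0 assms(2,4) by (simp add: \<gamma>_def)
    have "\<gamma> \<le> (\<tau> - \<sigma>0) / 8" "\<gamma> \<le> min t s / 4" unfolding \<gamma>_def by (rule min.cobounded1, rule min.cobounded2)
    then show "8 * \<gamma> \<le> \<tau> - \<sigma>0" "4 * \<gamma> \<le> t" "4 * \<gamma> \<le> s" "4 * \<gamma> \<le> min t s" by auto
  qed
  have su: "s' \<le> 1" "0 < u" "u \<le> s'" "u < t"
    using \<gamma> assms(2-5) by (auto simp: s'_def u_def)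
  have m: "0 < m" "m < dm - 1 + s" using dm su \<gamma> by (auto simp: m_def s'_def)
  have \<sigma>: "0 < \<sigma>" "\<sigma>0 \<le> \<sigma>" "\<sigma> + 3 * \<gamma> < u + m"
    using \<gamma> dm by (auto simp: \<sigma>_def u_def m_def s'_def \<tau>_def)
  obtain A where A: "0 < A"
    and bound: "\<And>k I C Q P a b. \<lbrakk>finite (I :: nat set); \<And>n p q. n \<in> I \<Longrightarrow> p \<in> C n \<Longrightarrow> q \<in> C n \<Longrightarrow> dist p q \<le> (1/2) ^ k;
       finite Q; Q \<subseteq> F; Q \<noteq> {};
       \<And>f r. f \<in> Q \<Longrightarrow> (1/2) ^ k \<le> r \<Longrightarrow> real (card {g\<in>Q. c2dist f g \<le> r}) \<le> 2 * (r / (1/2) ^ k) powr u;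
       \<And>f. f \<in> Q \<Longrightarrow> finite (P f); \<And>f. f \<in> Q \<Longrightarrow> P f \<subseteq> unit_cube;
       \<And>f x r. f \<in> Q \<Longrightarrow> x \<in> P f \<Longrightarrow> (1/2) ^ k \<le> r \<Longrightarrow> real (card {p\<in>P f. dist x p \<le> r}) \<le> 2 * (r / (1/2) ^ k) powr m;
       \<And>f x. f \<in> Q \<Longrightarrow> x \<in> P f \<Longrightarrow> (x, f x) \<in> (\<Union>n\<in>I. C n);
       0 \<le> a; a \<le> ((1/2) ^ k) powr u * real (card Q); 0 \<le> b;
       \<And>f. f \<in> Q \<Longrightarrow> b \<le> ((1/2) ^ k) powr m * real (card (P f))\<rbrakk>
     \<Longrightarrow> a * b\<^sup>2 \<le> A * (real k + 1)\<^sup>2 * real (card I) * ((1/2) ^ k) powr (u + m)"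
    by (rule discretized_incidence_bound[OF cin assms(1) su(1,2,3) m_def[unfolded dm_def]]) blast
  define X where "X f = {x\<in>unit_cube. (x, f x) \<in> E}" for f
  have Xpos: "0 < hcontent dist m (X f)" if f: "f \<in> F" for f
  proof (rule ccontr)
    assume "\<not> 0 < hcontent dist m (X f)"
    then have 0: "hcontent dist m (X f) = 0" by (simp add: zero_less_iff_neq_zero)
    have f2: "f \<in> C2_cube" using f F2 by auto
    have fn: "0 \<le> c2norm f" by (rule c2normE[OF f2]) simp
    have "hcontent dist m ((\<lambda>x. (x, f x)) ` X f) = 0"
    proof (rule hcontent_Lipschitz_null[OF 0])
      show "0 < 1 + c2norm f" using fn by simp
      fix x y assume "x \<in> X f" "y \<in> X f"
      then have "\<bar>f x - f y\<bar> \<le> c2norm f * norm (x - y)" using C2_cube_estimates(2)[OF f2] by (simp add: X_def)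
      moreover have "dist (x, f x) (y, f y) \<le> dist x y + dist (f x) (f y)"
        unfolding dist_Pair_Pair by (rule sqrt_sum_squares_le_sum) simp_all
      ultimately show "dist (x, f x) (y, f y) \<le> (1 + c2norm f) * dist x y"
        by (simp add: dist_real_def dist_norm distrib_right)
    qed
    moreover have "E \<inter> graph_cube f \<subseteq> (\<lambda>x. (x, f x)) ` X f" by (auto simp: graph_cube_def X_def)
    ultimately have "hcontent dist m (E \<inter> graph_cube f) = 0" using hcontent_mono by (metis le_zero_eq)
    moreover have "0 < hcontent dist m (E \<inter> graph_cube f)"
      using hausdorff_measure_neq_0[OF dimE[OF f] _ m(2)] m(1) by (intro hcontent_pos) auto
    ultimately show False by simp
  qed
  have Fpos: "0 < hcontent c2dist u F"
    using hausdorff_measure_neq_0[OF dimF _ su(4)] su(2) c2dist_nonneg F2 by (intro hcontent_pos) auto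
  \<comment> \<open>Positive content of \<open>X f\<close> is not uniform in \<open>f\<close>.
    Countable subadditivity provides one \<open>j\<close> for which the members with content at
    least \<open>1 / Suc j\<close> form a family of positive content.\<close>
  define F1 where "F1 j = {f\<in>F. ennreal (1 / real (Suc j)) \<le> hcontent dist m (X f)}" for j
  have "F \<subseteq> (\<Union>j. F1 j)"
  proof
    fix f assume f: "f \<in> F"
    obtain a where a: "0 < a" "ennreal a \<le> hcontent dist m (X f)" using ennreal_pos_lower[OF Xpos[OF f]] by blast
    obtain j where "inverse (real (Suc j)) < a" using reals_Archimedean a(1) by blast
    then have "ennreal (1 / real (Suc j)) \<le> ennreal a" by (intro ennreal_leI) (simp add: divide_inverse)
    then show "f \<in> (\<Union>j. F1 j)" using f a(2) unfolding F1_def by (blast intro: order_trans)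
  qed
  then have "0 < (\<Sum>j. hcontent c2dist u (F1 j))"
    by (rule order_less_le_trans[OF Fpos order_trans[OF hcontent_mono hcontent_UN_le]])
  then have "\<exists>j. 0 < hcontent c2dist u (F1 j)"
    by (rule contrapos_pp) (simp add: zero_less_iff_neq_zero)
  then obtain j where "0 < hcontent c2dist u (F1 j)" by blast
  then obtain a0 where a0: "0 < a0" "ennreal a0 \<le> hcontent c2dist u (F1 j)" by (rule ennreal_pos_lower)
  define b0 where "b0 = 1 / real (Suc j)"
  define G where "G = F1 j"
  have b0: "0 < b0" "\<And>f. f \<in> G \<Longrightarrow> ennreal b0 \<le> hcontent dist m (X f)" by (auto simp: b0_def G_def F1_def)
  have GF: "G \<subseteq> F" by (auto simp: G_def F1_def)
  \<comment> \<open>\<open>q ^ k\<close> is \<open>\<delta> powr \<gamma>\<close> for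
    \<open>\<delta> = (1/2) ^ k\<close>, so geometric weights lose only a small power of the scale.
    The factor \<open>(1 - q) / 2\<close> in \<open>w\<close> makes their sum 1/2.\<close>
  define q where "q = (1/2::real) powr \<gamma>"
  have q: "0 < q" "q < 1" using \<gamma>(1) powr_less_mono2[of \<gamma> "1/2" 1] by (auto simp: q_def)
  define w where "w k = (1 - q) / 2 * q ^ k" for k
  have w: "\<And>k. 0 < w k" "\<And>k. 0 \<le> w k" "summable w" "(\<Sum>k. w k) < 1"
  proof -
    show w0: "0 < w k" for k using q by (simp add: w_def)
    then show "0 \<le> w k" for k by (simp add: less_imp_le)
    have "w sums ((1 - q) / 2 * (1 / (1 - q)))" unfolding w_def using q by (intro sums_mult geometric_sums) simp
    moreover have "(1 - q) / 2 * (1 / (1 - q)) = 1/2" using q by (simp add: divide_simps)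
    ultimately have "w sums (1/2)" by (simp only:)
    then show "summable w" "(\<Sum>k. w k) < 1" by (auto simp: sums_iff)
  qed
  define c where "c = (a0 / 6 powr u) * (b0 / 6 powr m)\<^sup>2 * ((1 - q) / 2) ^ 3"
  have c: "0 < c" using a0 b0 q by (simp add: c_def)
  \<comment> \<open>\<open>x ^ k\<close> is \<open>(1/2) ^ k\<close> raised to the surplus left in
    the exponent budget, and so it beats the squared logarithm.\<close>
  define x where "x = 2 powr (\<sigma> + 3 * \<gamma> - (u + m))"
  have x: "0 < x" "x < 1" using \<sigma>(3) powr_less_mono[of "\<sigma> + 3 * \<gamma> - (u + m)" 0 2] by (auto simp: x_def)
  have "eventually (\<lambda>k. (real k + 1)\<^sup>2 * x ^ k < c / (A * 2 powr \<sigma>)) sequentially"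
    using c A by (intro order_tendstoD[OF square_times_power_limit_0[OF x]]) simp
  then obtain k0 where k0: "\<And>k. k0 \<le> k \<Longrightarrow> (real k + 1)\<^sup>2 * x ^ k < c / (A * 2 powr \<sigma>)"
    by (auto simp: eventually_sequentially)
  \<comment> \<open>With total cost below \<open>e\<close>, no covering set can have radius
    \<open>(1/2) ^ k0\<close> or more; this forces the scale found below to be fine enough.\<close>
  define e where "e = ((1/2::real) ^ k0) powr \<sigma>"
  have e: "0 < e" "e \<le> 1" using \<sigma>(1) by (auto simp: e_def power_le_one intro!: powr_le1)
  obtain C r where C: "\<And>n. 0 < r n" "\<And>n p q. p \<in> C n \<Longrightarrow> q \<in> C n \<Longrightarrow> dist p q \<le> r n"
    "E \<subseteq> (\<Union>n::nat. C n)" "(\<Sum>n. ennreal (r n powr \<sigma>)) < ennreal e"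
    by (rule null_hausdorff_coverE[OF _ \<sigma>0(2,1) \<sigma>(2,1) e]) auto
  have rsmall: "r n < (1/2) ^ k0" for n
  proof (rule ccontr)
    assume "\<not> r n < (1/2) ^ k0"
    then have "e \<le> r n powr \<sigma>" unfolding e_def using \<sigma>(1) by (intro powr_mono2) auto
    then have "ennreal e \<le> (\<Sum>n. ennreal (r n powr \<sigma>))"
      using ennreal_term_le_suminf[of "\<lambda>n. ennreal (r n powr \<sigma>)" n] by (meson ennreal_leI order_trans)
    with C(4) show False by simp
  qed
  have sum1: "(\<Sum>n. ennreal (r n powr \<sigma>)) < 1"
    using C(4) e(2) by (metis ennreal_1 ennreal_leI order_less_le_trans)
  define I where "I k = {n. (1/2) ^ Suc k < r n \<and> r n \<le> (1/2) ^ k}" for k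
  have Iex: "\<exists>k. n \<in> I k" for n
    using dyadic_scale[OF C(1)[of n]] rsmall[of n] power_le_one[of "1/2::real" k0] by (auto simp: I_def)
  define Xk where "Xk k f = {x\<in>unit_cube. (x, f x) \<in> (\<Union>n\<in>I k. C n)}" for k f
  \<comment> \<open>For each \<open>f\<close> some scale captures a share \<open>w k\<close> of the
    content of \<open>X f\<close>, but this \<open>k\<close> depends on \<open>f\<close>. A second
    pigeonholing, over the sets \<open>Gk k\<close>, fixes a common scale.\<close>
  define Gk where "Gk k = {f\<in>G. ennreal (b0 * w k) \<le> hcontent dist m (Xk k f)}" for k
  have "G \<subseteq> (\<Union>k. Gk k)"
  proof
    fix f assume f: "f \<in> G"
    have "X f \<subseteq> (\<Union>k. Xk k f)" using Iex C(3) by (fastforce simp: X_def Xk_def)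
    then have "\<exists>k. ennreal (b0 * w k) \<le> hcontent dist m (Xk k f)"
      by (intro hcontent_pigeonhole[OF b0(2)[OF f] b0(1)] w)
    then show "f \<in> (\<Union>k. Gk k)" using f by (auto simp: Gk_def)
  qed
  from hcontent_pigeonhole[OF a0(2)[folded G_def] a0(1) this w(2-4)]
  obtain k where k: "ennreal (a0 * w k) \<le> hcontent c2dist u (Gk k)" by blast
  have aw: "0 < a0 * w k" and bw: "0 < b0 * w k" using a0(1) b0(1) w(1) by auto
  \<comment> \<open>For \<open>k < k0\<close> no covering set has scale \<open>k\<close>, so
    \<open>Gk k\<close> would be empty, contrary to its positive content.\<close>
  have "k0 \<le> k"
  proof (rule ccontr)
    assume "\<not> k0 \<le> k"
    then have "(1/2) ^ k0 \<le> (1/2::real) ^ Suc k" by (intro power_decreasing) auto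
    then have "\<not> (1/2) ^ Suc k < r n" for n using rsmall[of n] by linarith
    then have "I k = {}" unfolding I_def by blast
    then have "Xk k f = {}" for f by (simp add: Xk_def)
    then have "Gk k = {}" using bw by (auto simp: Gk_def hcontent_empty)
    then show False using k a0(1) w(1)[of k] by (simp add: hcontent_empty)
  qed
  define \<delta> where "\<delta> = (1/2::real) ^ k"
  have \<delta>: "0 < \<delta>" by (simp add: \<delta>_def)
  have GkF: "Gk k \<subseteq> F" using GF by (auto simp: Gk_def)
  then have Gk2: "Gk k \<subseteq> C2_cube" using F2 by blast
  have "\<exists>Q. finite Q \<and> Q \<subseteq> Gk k \<and> (\<forall>f\<in>Gk k. \<forall>r\<ge>\<delta>. real (card {g\<in>Q. c2dist f g \<le> r}) \<le> 2 * (r / \<delta>) powr u)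
      \<and> a0 * w k \<le> 6 powr u * \<delta> powr u * real (card Q)"
  proof (rule Frostman_finite_set)
    show "c2dist f f = 0" if "f \<in> Gk k" for f using that Gk2 c2dist_self by blast
    show "0 \<le> c2dist f g" if "f \<in> Gk k" "g \<in> Gk k" for f g using that Gk2 c2dist_nonneg by blast
    show "c2dist f g = c2dist g f" if "f \<in> Gk k" "g \<in> Gk k" for f g using that Gk2 c2dist_commute by blast
    show "c2dist f h \<le> c2dist f g + c2dist g h" if "f \<in> Gk k" "g \<in> Gk k" "h \<in> Gk k" for f g h
      using that Gk2 by (intro c2dist_triangle) auto
    show "c2dist f g \<le> K" if "f \<in> Gk k" "g \<in> Gk k" for f g using that GkF cinematic_c2dist_le[OF cin] by blast
  qed (use k aw su \<delta> in auto)
  then obtain Q where Q: "finite Q" "Q \<subseteq> Gk k"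
    "\<And>f r. f \<in> Gk k \<Longrightarrow> \<delta> \<le> r \<Longrightarrow> real (card {g\<in>Q. c2dist f g \<le> r}) \<le> 2 * (r / \<delta>) powr u"
    "a0 * w k \<le> 6 powr u * \<delta> powr u * real (card Q)" by blast
  have "\<exists>P. finite P \<and> P \<subseteq> Xk k f \<and> (\<forall>x\<in>Xk k f. \<forall>r\<ge>\<delta>. real (card {p\<in>P. dist x p \<le> r}) \<le> 2 * (r / \<delta>) powr m)
      \<and> b0 * w k \<le> 6 powr m * \<delta> powr m * real (card P)" if "f \<in> Q" for f
  proof (rule Frostman_finite_set)
    show "ennreal (b0 * w k) \<le> hcontent dist m (Xk k f)" using that Q(2) by (auto simp: Gk_def)
    show "dist x y \<le> real CARD('n)" if "x \<in> Xk k f" "y \<in> Xk k f" for x y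
      using that by (intro dist_unit_cube_le) (auto simp: Xk_def)
    show "dist x y = dist y x" "dist x z \<le> dist x y + dist y z" for x y z :: "real^'n"
      by (rule dist_commute, rule dist_triangle)
  qed (use bw m \<delta> in auto)
  then have "\<forall>f\<in>Q. \<exists>P. finite P \<and> P \<subseteq> Xk k f \<and>
      (\<forall>x\<in>Xk k f. \<forall>r\<ge>\<delta>. real (card {p\<in>P. dist x p \<le> r}) \<le> 2 * (r / \<delta>) powr m)
      \<and> b0 * w k \<le> 6 powr m * \<delta> powr m * real (card P)" by (rule ballI)
  from bchoice[OF this] obtain P where P': "\<forall>f\<in>Q. finite (P f) \<and> P f \<subseteq> Xk k f \<and>
      (\<forall>x\<in>Xk k f. \<forall>r\<ge>\<delta>. real (card {p\<in>P f. dist x p \<le> r}) \<le> 2 * (r / \<delta>) powr m)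
      \<and> b0 * w k \<le> 6 powr m * \<delta> powr m * real (card (P f))" ..
  note P = bspec[OF P']
  have "(1/2::real) ^ Suc k > 0" by simp
  note I = card_scale_class[OF C(1) sum1 \<sigma>(1) _ this, of "I k"]
  have finI: "finite (I k)" and cardI: "real (card (I k)) * ((1/2) ^ Suc k) powr \<sigma> \<le> 1"
    by (rule I, simp add: I_def)+
  have "(a0 * w k / 6 powr u) * (b0 * w k / 6 powr m)\<^sup>2 \<le> A * (real k + 1)\<^sup>2 * real (card (I k)) * \<delta> powr (u + m)"
    unfolding \<delta>_def
  proof (rule bound[OF finI, of C k Q P])
    show "dist p q \<le> (1/2) ^ k" if "n \<in> I k" "p \<in> C n" "q \<in> C n" for n p q
      using C(2)[OF that(2,3)] that(1) by (auto simp: I_def)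
    show "Q \<noteq> {}" using Q(4) aw by auto
    show "Q \<subseteq> F" using Q(2) GkF by blast
    show "real (card {g\<in>Q. c2dist f g \<le> r}) \<le> 2 * (r / (1/2) ^ k) powr u" if "f \<in> Q" "(1/2) ^ k \<le> r" for f r
      using Q(3)[of f r] that Q(2) unfolding \<delta>_def by blast
    show "P f \<subseteq> unit_cube" if "f \<in> Q" for f using P[OF that] by (auto simp: Xk_def)
    show "real (card {p\<in>P f. dist x p \<le> r}) \<le> 2 * (r / (1/2) ^ k) powr m"
      if "f \<in> Q" "x \<in> P f" "(1/2) ^ k \<le> r" for f x r using P[OF that(1)] that(2,3) unfolding \<delta>_def by blast
    show "(x, f x) \<in> (\<Union>n\<in>I k. C n)" if "f \<in> Q" "x \<in> P f" for f x using P[OF that(1)] that(2) by (auto simp: Xk_def)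
    show "a0 * w k / 6 powr u \<le> ((1/2) ^ k) powr u * real (card Q)"
      using Q(4) unfolding \<delta>_def by (simp add: field_simps)
    show "b0 * w k / 6 powr m \<le> ((1/2) ^ k) powr m * real (card (P f))" if "f \<in> Q" for f
      using P[OF that] unfolding \<delta>_def by (simp add: field_simps)
  qed (use Q(1) P aw bw in auto)
  also have "(a0 * w k / 6 powr u) * (b0 * w k / 6 powr m)\<^sup>2 = c * (q ^ k) ^ 3"
  proof -
    have "(a * (h * y) / v) * (b * (h * y) / v')\<^sup>2 = (a / v) * (b / v')\<^sup>2 * h ^ 3 * y ^ 3" for a b h y v v' :: real
      by (simp add: power2_eq_square power3_eq_cube mult_ac)
    then show ?thesis unfolding c_def w_def by blast
  qed
  also have "A * (real k + 1)\<^sup>2 * real (card (I k)) * \<delta> powr (u + m)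
      \<le> A * (real k + 1)\<^sup>2 * (2 powr (\<sigma> * (real k + 1))) * \<delta> powr (u + m)"
  proof (intro mult_right_mono mult_left_mono)
    have "((1/2::real) ^ Suc k) powr \<sigma> = 1 / 2 powr (\<sigma> * (real k + 1))"
      unfolding half_power_powr powr_minus_divide by (simp add: add.commute)
    then have "real (card (I k)) * (1 / 2 powr (\<sigma> * (real k + 1))) \<le> 1" using cardI by (simp only:)
    then show "real (card (I k)) \<le> 2 powr (\<sigma> * (real k + 1))"
      by (simp only: times_divide_eq_right mult_1_right pos_divide_le_eq powr_gt_zero)
  qed (use A in auto)
  also have "\<dots> = A * 2 powr \<sigma> * ((real k + 1)\<^sup>2 * x ^ k) * (q ^ k) ^ 3"
  proof -
    have q3: "(q ^ k) ^ 3 = 2 powr (- 3 * \<gamma> * real k)"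
    proof -
      have "q = 2 powr - \<gamma>" by (simp add: q_def powr_divide powr_minus_divide)
      then show ?thesis by (simp add: powr_power[symmetric] powr_powr powr_realpow[symmetric] mult_ac)
    qed
    have xk: "x ^ k = 2 powr ((\<sigma> + 3 * \<gamma> - (u + m)) * real k)"
      by (simp add: x_def powr_powr powr_realpow[symmetric])
    have dk: "\<delta> powr (u + m) = 2 powr (- (u + m) * real k)"
      unfolding \<delta>_def half_power_powr by (simp only: minus_mult_left)
    have "2 powr (\<sigma> * (real k + 1)) * 2 powr (- (u + m) * real k)
        = 2 powr \<sigma> * 2 powr ((\<sigma> + 3 * \<gamma> - (u + m)) * real k) * 2 powr (- 3 * \<gamma> * real k)"
      unfolding powr_add[symmetric] by (simp add: algebra_simps)
    then show ?thesis unfolding q3 xk dk by (simp only: mult_ac)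
  qed
  finally have "c * (q ^ k) ^ 3 \<le> A * 2 powr \<sigma> * ((real k + 1)\<^sup>2 * x ^ k) * (q ^ k) ^ 3" .
  \<comment> \<open>The pigeonholing losses cancel exactly, since \<open>3 * \<gamma>\<close> was
    already charged in the definition of \<open>x\<close>.\<close>
  then have "c \<le> A * 2 powr \<sigma> * ((real k + 1)\<^sup>2 * x ^ k)" using q by simp
  moreover have "(real k + 1)\<^sup>2 * x ^ k < c / (A * 2 powr \<sigma>)" using k0[OF \<open>k0 \<le> k\<close>] .
  ultimately show False using A by (simp add: field_simps)
qed

end
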